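(* Let $N\ge 2$ be an integer and let $1\le p\le N$ be a real number. There exist a constant $\sigma_{N,p}>0$, depending only on $N$ and $p$, and, for every $0<\gamma<1$, a finite constant $C_{N,p,\gamma}>0$, depending only on $N$, $p$ and $\gamma$, with $C_{N,p,\gamma}\to+\infty$ as $\gamma\to 1$, such that for every $0<\gamma<1$ and every open set $\Omega\subseteq\mathbb{R}^N$ $$\sigma_{N,p}\,\gamma\,\left(\frac{1}{R_{p,\gamma}(\Omega)}\right)^p\le \lambda_p(\Omega)\le C_{N,p,\gamma}\,\left(\frac{1}{R_{p,\gamma}(\Omega)}\right)^p.$$ In particular, $\lambda_p(\Omega)>0$ if and only if $R_{p,\gamma}(\Omega)<+\infty$, and the last condition does not depend on $0<\gamma<1$.
   Context: $B_r(x_0)=\{x\in\mathbb{R}^N: |x-x_0|<r\}$. $C^\infty_0(\Omega)$ is the space of infinitely differentiable functions whose support is a compact subset of $\Omega$. The sharp $L^p$ Poincaré constant of an open set $\Omega\subseteq\mathbb{R}^N$ is $$\lambda_p(\Omega)=\inf_{\varphi\in C^\infty_0(\Omega)}\left\{\int_\Omega|\nabla\varphi|^p\,dx : \|\varphi\|_{L^p(\Omega)}=1\right\}.$$ For an open set $E\subseteq\mathbb{R}^N$ and a compact set $\Sigma\subseteq E$, the $p$-capacity of $\Sigma$ relative to $E$ is $$\mathrm{cap}_p(\Sigma;E)=\inf_{\varphi\in C^\infty_0(E)}\left\{\int_E|\nabla\varphi|^p\,dx : \varphi\ge 1\text{ on }\Sigma\right\}.$$ For $0<\gamma<1$, a compact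 set $\Sigma\subseteq\overline{B_r(x_0)}$ is called $(p,\gamma)$-negligible (with respect to this ball) if $\mathrm{cap}_p(\Sigma;B_{2r}(x_0))\le\gamma\,\mathrm{cap}_p(\overline{B_r(x_0)};B_{2r}(x_0))$. The capacitary inradius of $\Omega$ is $$R_{p,\gamma}(\Omega)=\sup\Big\{r>0 : \exists x_0\in\mathbb{R}^N\text{ such that }\overline{B_r(x_0)}\setminus\Omega\text{ is }(p,\gamma)\text{-negligible}\Big\}\in[0,+\infty].$$ Conventions: $1/(+\infty)=0$, so $\lambda_p(\Omega)=0$ when $R_{p,\gamma}(\Omega)=+\infty$; for $\Omega=\emptyset$ one takes $\sup\emptyset=0$, $\inf\emptyset=+\infty$, $1/0=+\infty$. *)

theory Defs
  imports "HOL-Analysis.Analysis"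
begin

text \<open>\<open>C_k k f\<close>: the function is \<open>k\<close> times continuously differentiable on the whole space.\<close>

primrec C_k :: "nat \<Rightarrow> ('a::euclidean_space \<Rightarrow> real) \<Rightarrow> bool" where
  "C_k 0 f \<longleftrightarrow> continuous_on UNIV f"
| "C_k (Suc k) f \<longleftrightarrow>
     (\<forall>x. f differentiable (at x)) \<and> (\<forall>v. C_k k (\<lambda>x. frechet_derivative f (at x) v))"

definition smooth :: "('a::euclidean_space \<Rightarrow> real) \<Rightarrow> bool" where
  "smooth f \<longleftrightarrow> (\<forall>k. C_k k f)"

text \<open>Elements of \<open>C\<^sub>0\<^sup>\<infinity>(\<Omega>)\<close> are represented by their extension by zero to the whole space.\<close>

definition test_functions :: "'a::euclidean_space set \<Rightarrow> ('a \<Rightarrow> real) set" where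
  "test_functions \<Omega> =
     {\<phi>. smooth \<phi> \<and> compact (closure {x. \<phi> x \<noteq> 0}) \<and> closure {x. \<phi> x \<noteq> 0} \<subseteq> \<Omega>}"

definition gradient :: "('a::euclidean_space \<Rightarrow> real) \<Rightarrow> 'a \<Rightarrow> 'a" where
  "gradient f x = (\<Sum>b\<in>Basis. frechet_derivative f (at x) b *\<^sub>R b)"

text \<open>Power with a real exponent on \<open>[0,\<infinity>]\<close>; only meant for exponents \<open>a > 0\<close>.\<close>

definition epowr :: "ennreal \<Rightarrow> real \<Rightarrow> ennreal" where
  "epowr x a = (if x = \<infinity> then \<infinity> else ennreal (enn2real x powr a))"

definition Lp_norm :: "real \<Rightarrow> 'a::euclidean_space set \<Rightarrow> ('a \<Rightarrow> real) \<Rightarrow> ennreal" where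
  "Lp_norm p \<Omega> \<phi> = epowr (\<integral>\<^sup>+x\<in>\<Omega>. ennreal (\<bar>\<phi> x\<bar> powr p) \<partial>lborel) (1 / p)"

definition dirichlet_energy :: "real \<Rightarrow> 'a::euclidean_space set \<Rightarrow> ('a \<Rightarrow> real) \<Rightarrow> ennreal" where
  "dirichlet_energy p \<Omega> \<phi> = (\<integral>\<^sup>+x\<in>\<Omega>. ennreal (norm (gradient \<phi> x) powr p) \<partial>lborel)"

definition poincare_const :: "real \<Rightarrow> 'a::euclidean_space set \<Rightarrow> ennreal" where
  "poincare_const p \<Omega> =
     Inf {dirichlet_energy p \<Omega> \<phi> | \<phi>. \<phi> \<in> test_functions \<Omega> \<and> Lp_norm p \<Omega> \<phi> = 1}"

definition capacity :: "real \<Rightarrow> 'a::euclidean_space set \<Rightarrow> 'a set \<Rightarrow> ennreal" where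
  "capacity p \<Sigma> E =
     Inf {dirichlet_energy p E \<phi> | \<phi>. \<phi> \<in> test_functions E \<and> (\<forall>x\<in>\<Sigma>. 1 \<le> \<phi> x)}"

definition capacity_negligible ::
    "real \<Rightarrow> real \<Rightarrow> 'a::euclidean_space \<Rightarrow> real \<Rightarrow> 'a set \<Rightarrow> bool" where
  "capacity_negligible p \<gamma> x\<^sub>0 r \<Sigma> \<longleftrightarrow>
     compact \<Sigma> \<and> \<Sigma> \<subseteq> cball x\<^sub>0 r \<and>
     capacity p \<Sigma> (ball x\<^sub>0 (2 * r)) \<le> ennreal \<gamma> * capacity p (cball x\<^sub>0 r) (ball x\<^sub>0 (2 * r))"

definition capacitary_inradius :: "real \<Rightarrow> real \<Rightarrow> 'a::euclidean_space set \<Rightarrow> ennreal" where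
  "capacitary_inradius p \<gamma> \<Omega> =
     Sup {ennreal r | r. 0 < r \<and> (\<exists>x\<^sub>0. capacity_negligible p \<gamma> x\<^sub>0 r (cball x\<^sub>0 r - \<Omega>))}"

end

theory Submission
  imports Defs
begin

text \<open>
  Lower bound. Let \<open>r\<close> exceed the capacitary inradius and let \<open>u\<close> be a test function in \<open>\<Omega>\<close>. For every
  \<open>y\<close>, the function \<open>\<eta> (1 - u / u y)\<close>, with a cut-off \<open>\<eta>\<close> at scale \<open>r\<close> around \<open>y\<close>, is admissible for
  the capacity of \<open>cball y r - \<Omega>\<close>, which is at least a constant times \<open>\<gamma> r\<^sup>N\<^sup>-\<^sup>p\<close>. This bounds
  \<open>\<bar>u y\<bar>\<^sup>p\<close> by local integrals of the gradient and of the differences \<open>u x - u y\<close>. Integrating over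
  \<open>y\<close> in the whole space replaces any covering argument, and the differences are controlled
  by translation estimates.

  Upper bound. After rescaling to \<open>r = 1\<close>, let \<open>\<psi>\<close> almost realise the capacity of the negligible
  set and take \<open>\<phi> = \<eta> w\<close>, where \<open>w\<close> is a smooth version of the positive part of \<open>1 - \<psi>\<close> and \<open>\<eta>\<close>
  cuts off inside the unit ball. Up to a small error \<open>\<psi> + \<eta>\<^sup>2 w\<close> is at least 1 on a slightly smaller
  ball, and its gradient is at most \<open>\<bar>\<nabla>\<psi>\<bar> + 2 \<bar>\<nabla>\<eta>\<bar> \<phi>\<close>. Since the energy of \<open>\<psi>\<close> is at most
  \<open>\<gamma> < 1\<close> times the capacity of the unit ball, and the capacity of balls is left-continuous in the
  radius, \<open>\<phi>\<close> cannot be small in \<open>L\<^sup>p\<close>.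
\<close>

section \<open>Calculus of smooth functions\<close>

text \<open>The upper bound has to work for every \<gamma> < 1, so no fixed factor may be lost in
  front of the energy of \<psi>. Two devices serve this. First, the gradient of \<psi> +
  \<open>\<eta>\<^sup>2 w\<close> keeps only a multiple of the gradient of \<psi> with factor
  between 0 and 1, because w decreases where \<psi> increases; adding w never adds energy of its
  own. Second, sums are expanded with the weighted inequality \<open>powr_add_le\<close>, whose
  leading factor can be brought as close to 1 as desired. The square on \<eta> is forced as well:
  cutting off once would leave the error w times the gradient of \<eta>, which \<phi> = \<eta> w
  does not control, while the square leaves 2 \<phi> times that gradient. For the lower bound fixed
  factors are harmless and only powers of r count: averaging over a ball of shifts produces its
  volume, of order r^N, which cancels the r^N in the capacity of a ball and leaves the scale
  r^(-p).\<close>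

lemma C_k_SucI:
  assumes "\<And>x. (f has_derivative f' x) (at x)" "\<And>v. C_k k (\<lambda>x. f' x v)"
  shows "C_k (Suc k) f"
proof -
  have "frechet_derivative f (at x) = f' x" for x
    using assms(1) frechet_derivative_at by metis
  then show ?thesis
    using assms by (auto simp: differentiable_def)
qed

lemma C_k_SucD:
  assumes "C_k (Suc k) f"
  shows "(f has_derivative frechet_derivative f (at x)) (at x)"
    and "C_k k (\<lambda>x. frechet_derivative f (at x) v)"
  using assms by (simp_all add: frechet_derivative_works[symmetric])

lemma C_k_Suc_imp: "C_k (Suc k) f \<Longrightarrow> C_k k f"
proof (induction k arbitrary: f)
  case 0
  then have "\<forall>x. f differentiable at x" by simp
  then show ?case
    by (simp add: continuous_on_eq_continuous_at differentiable_imp_continuous_within)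
next
  case (Suc k)
  then show ?case by (metis C_k.simps(2))
qed

lemma C_k_const: "C_k k (\<lambda>x. c)"
proof (induction k arbitrary: c)
  case (Suc k)
  show ?case by (rule C_k_SucI[where f' = "\<lambda>x v. 0"]) (auto intro: Suc)
qed simp

lemma C_k_bounded_linear:
  assumes "bounded_linear f" shows "C_k k f"
proof (cases k)
  case 0
  then show ?thesis using assms by (simp add: linear_continuous_on)
next
  case (Suc j)
  show ?thesis unfolding Suc
    by (rule C_k_SucI[where f' = "\<lambda>x. f"])
      (auto intro: C_k_const bounded_linear_imp_has_derivative assms)
qed

lemma C_k_add: "C_k k f \<Longrightarrow> C_k k g \<Longrightarrow> C_k k (\<lambda>x. f x + g x)"
proof (induction k arbitrary: f g)
  case (Suc k)
  show ?case
    by (rule C_k_SucI[OF has_derivative_add[OF C_k_SucD(1)[OF Suc.prems(1)] C_k_SucD(1)[OF Suc.prems(2)]]])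
      (intro Suc.IH C_k_SucD(2)[OF Suc.prems(1)] C_k_SucD(2)[OF Suc.prems(2)])
qed (simp add: continuous_on_add)

lemma C_k_mult: "C_k k f \<Longrightarrow> C_k k g \<Longrightarrow> C_k k (\<lambda>x. f x * g x)"
proof (induction k arbitrary: f g)
  case (Suc k)
  show ?case
    by (rule C_k_SucI[OF has_derivative_mult[OF C_k_SucD(1)[OF Suc.prems(1)] C_k_SucD(1)[OF Suc.prems(2)]]])
      (intro C_k_add Suc.IH C_k_SucD(2)[OF Suc.prems(1)] C_k_SucD(2)[OF Suc.prems(2)]
         C_k_Suc_imp[OF Suc.prems(1)] C_k_Suc_imp[OF Suc.prems(2)])
qed (simp add: continuous_on_mult)

text \<open>The derivative of 1/f contains 1/f itself, so the induction hypothesis is applied to the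
  same f, one order lower.\<close>

lemma C_k_inverse: "C_k k f \<Longrightarrow> (\<And>x. f x \<noteq> 0) \<Longrightarrow> C_k k (\<lambda>x. inverse (f x))"
proof (induction k arbitrary: f)
  case (Suc k)
  have inv: "C_k k (\<lambda>x. inverse (f x))"
    by (intro Suc.IH C_k_Suc_imp[OF Suc.prems(1)] Suc.prems(2))
  have "((\<lambda>x. inverse (f x)) has_derivative
      (\<lambda>v. (-1) * (inverse (f x) * frechet_derivative f (at x) v * inverse (f x)))) (at x)" for x
    using Deriv.has_derivative_inverse[OF Suc.prems(2) C_k_SucD(1)[OF Suc.prems(1)]]
    by (simp add: mult.assoc)
  then show ?case
    by (rule C_k_SucI) (intro C_k_mult inv C_k_const C_k_SucD(2)[OF Suc.prems(1)])
qed (simp add: continuous_on_inverse)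

text \<open>The chain rule replaces g by its derivative but keeps f, so the induction must run over
  f and g simultaneously.\<close>

lemma C_k_compose:
  fixes g :: "real \<Rightarrow> real"
  shows "C_k k f \<Longrightarrow> C_k k g \<Longrightarrow> C_k k (\<lambda>x. g (f x))"
proof (induction k arbitrary: f g)
  case 0
  then show ?case by (auto intro: continuous_on_compose2)
next
  case (Suc k)
  let ?g' = "\<lambda>t. frechet_derivative g (at t) 1"
  have "((\<lambda>x. g (f x)) has_derivative (\<lambda>v. frechet_derivative f (at x) v * ?g' (f x))) (at x)" for x
  proof -
    have "linear (frechet_derivative g (at (f x)))"
      using C_k_SucD(1)[OF Suc.prems(2)] has_derivative_linear by blast
    then have "frechet_derivative g (at (f x)) = (\<lambda>s. s * ?g' (f x))"
      by (metis linear_scale mult.right_neutral real_scaleR_def)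
    then have eq: "frechet_derivative g (at (f x)) (frechet_derivative f (at x) v)
        = frechet_derivative f (at x) v * ?g' (f x)" for v
      by (rule fun_cong)
    show ?thesis
      using has_derivative_compose[OF C_k_SucD(1)[OF Suc.prems(1)] C_k_SucD(1)[OF Suc.prems(2)], of x]
      by (simp only: eq)
  qed
  moreover have "C_k k (\<lambda>x. frechet_derivative f (at x) v * ?g' (f x))" for v
  proof (rule C_k_mult)
    show "C_k k (\<lambda>x. frechet_derivative f (at x) v)"
      by (rule C_k_SucD(2)[OF Suc.prems(1)])
    have "C_k k ?g'"
      by (rule C_k_SucD(2)[OF Suc.prems(2)])
    then show "C_k k (\<lambda>x. ?g' (f x))"
      by (rule Suc.IH[OF C_k_Suc_imp[OF Suc.prems(1)]])
  qed
  ultimately show ?case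
    by (rule C_k_SucI[where f' = "\<lambda>x v. frechet_derivative f (at x) v * ?g' (f x)"])
qed

text \<open>The scalar is absorbed into the direction: the derivative in direction v is the
  derivative of f in direction \<open>a *\<^sub>R v\<close>, composed with the same affine map. The
  induction hypothesis then applies directly.\<close>

lemma C_k_affine: "C_k k f \<Longrightarrow> C_k k (\<lambda>x. f (b + a *\<^sub>R x))"
proof (induction k arbitrary: f)
  case 0
  then show ?case
    by (auto intro!: continuous_on_compose2[of UNIV f] continuous_intros)
next
  case (Suc k)
  have "((\<lambda>x. f (b + a *\<^sub>R x)) has_derivative
      (\<lambda>v. frechet_derivative f (at (b + a *\<^sub>R x)) (a *\<^sub>R v))) (at x)" for x
    by (rule has_derivative_compose[where g = f])
      (auto intro!: derivative_eq_intros C_k_SucD(1)[OF Suc.prems])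
  then show ?case
    by (rule C_k_SucI) (rule Suc.IH[OF C_k_SucD(2)[OF Suc.prems]])
qed

lemma C_k_inner_self: "C_k k (\<lambda>x. x \<bullet> x)"
proof (cases k)
  case 0
  then show ?thesis by (auto intro!: continuous_intros)
next
  case (Suc j)
  have "((\<lambda>x. x \<bullet> x) has_derivative (\<lambda>v. x \<bullet> v + v \<bullet> x)) (at x)" for x :: 'a
    by (auto intro!: derivative_eq_intros)
  then show ?thesis unfolding Suc
    by (rule C_k_SucI)
      (intro C_k_add C_k_bounded_linear bounded_linear_inner_left bounded_linear_inner_right)
qed

section \<open>Closure properties of smooth functions\<close>

lemma smooth_C_k: "smooth f \<Longrightarrow> C_k k f"
  by (simp add: smooth_def)

lemma smooth_const: "smooth (\<lambda>x. c)"
  by (simp add: smooth_def C_k_const)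

lemma smooth_add: "smooth f \<Longrightarrow> smooth g \<Longrightarrow> smooth (\<lambda>x. f x + g x)"
  by (simp add: smooth_def C_k_add)

lemma smooth_mult: "smooth f \<Longrightarrow> smooth g \<Longrightarrow> smooth (\<lambda>x. f x * g x)"
  by (simp add: smooth_def C_k_mult)

lemma smooth_diff: "smooth f \<Longrightarrow> smooth g \<Longrightarrow> smooth (\<lambda>x. f x - g x)"
  using smooth_add[OF _ smooth_mult[OF smooth_const[of "-1"]], of f g] by simp

lemma smooth_inverse: "smooth f \<Longrightarrow> (\<And>x. f x \<noteq> 0) \<Longrightarrow> smooth (\<lambda>x. inverse (f x))"
  by (simp add: smooth_def C_k_inverse)

lemma smooth_compose: "smooth f \<Longrightarrow> smooth (g::real\<Rightarrow>real) \<Longrightarrow> smooth (\<lambda>x. g (f x))"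
  by (simp add: smooth_def C_k_compose)

lemma smooth_affine: "smooth f \<Longrightarrow> smooth (\<lambda>x. f (b + a *\<^sub>R x))"
  by (simp add: smooth_def C_k_affine)

lemma smooth_inner_self: "smooth (\<lambda>x. x \<bullet> x)"
  by (simp add: smooth_def C_k_inner_self)

lemma smooth_ident: "smooth (\<lambda>x::real. x)"
  by (simp add: smooth_def C_k_bounded_linear)

section \<open>Gradients\<close>

lemma smooth_GDERIV:
  assumes "smooth f" shows "GDERIV f x :> gradient f x"
proof -
  have D: "(f has_derivative frechet_derivative f (at x)) (at x)"
    by (rule C_k_SucD(1)[OF smooth_C_k[OF assms, of "Suc 0"]])
  then have lin: "linear (frechet_derivative f (at x))"
    by (rule has_derivative_linear)
  have "frechet_derivative f (at x) v = v \<bullet> gradient f x" for v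
  proof -
    have "frechet_derivative f (at x) v = frechet_derivative f (at x) (\<Sum>b\<in>Basis. (v \<bullet> b) *\<^sub>R b)"
      by (simp add: euclidean_representation)
    also have "\<dots> = (\<Sum>b\<in>Basis. (v \<bullet> b) *\<^sub>R frechet_derivative f (at x) b)"
      by (simp only: linear_sum[OF lin] linear_scale[OF lin])
    also have "\<dots> = v \<bullet> gradient f x"
      by (simp add: gradient_def inner_sum_right mult.commute)
    finally show ?thesis .
  qed
  then have "frechet_derivative f (at x) = (\<lambda>v. v \<bullet> gradient f x)" by blast
  then show ?thesis using D by (simp add: gderiv_def)
qed

lemma gradient_eqI:
  assumes "GDERIV f x :> D" shows "gradient f x = D"
proof -
  have "frechet_derivative f (at x) = (\<lambda>v. v \<bullet> D)"
    using assms frechet_derivative_at unfolding gderiv_def by metis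
  then show ?thesis
    by (simp add: gradient_def inner_commute[of _ D] euclidean_representation)
qed

lemma smooth_continuous_on: "smooth f \<Longrightarrow> continuous_on UNIV f"
  using smooth_C_k[of f 0] by simp

lemma continuous_on_gradient:
  assumes "smooth f" shows "continuous_on UNIV (gradient f)"
proof -
  have "continuous_on UNIV (\<lambda>x. frechet_derivative f (at x) v)" for v
    using C_k_SucD(2)[OF smooth_C_k[OF assms, of "Suc 0"], of v] by simp
  then show ?thesis
    unfolding gradient_def[abs_def] by (intro continuous_intros) auto
qed

lemma gradient_add:
  assumes "smooth f" "smooth g"
  shows "gradient (\<lambda>x. f x + g x) x = gradient f x + gradient g x"
  by (intro gradient_eqI GDERIV_add smooth_GDERIV assms)

lemma gradient_mult:
  assumes "smooth f" "smooth g"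
  shows "gradient (\<lambda>x. f x * g x) x = f x *\<^sub>R gradient g x + g x *\<^sub>R gradient f x"
  by (intro gradient_eqI GDERIV_mult smooth_GDERIV assms)

lemma gradient_const: "gradient (\<lambda>x. c) x = 0"
  by (rule gradient_eqI[OF GDERIV_const])

lemma gradient_cmult:
  assumes "smooth f"
  shows "gradient (\<lambda>x. c * f x) x = c *\<^sub>R gradient f x"
  by (simp add: gradient_mult[OF smooth_const assms] gradient_const)

lemma gradient_const_diff:
  assumes "smooth f"
  shows "gradient (\<lambda>x. c - f x) x = - gradient f x"
  using gradient_eqI[OF GDERIV_diff[OF GDERIV_const smooth_GDERIV[OF assms]]] by simp

lemma gradient_affine:
  assumes "smooth f"
  shows "gradient (\<lambda>x. f (b + a *\<^sub>R x)) x = a *\<^sub>R gradient f (b + a *\<^sub>R x)"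
proof (rule gradient_eqI)
  have "((\<lambda>x. f (b + a *\<^sub>R x)) has_derivative (\<lambda>v. (a *\<^sub>R v) \<bullet> gradient f (b + a *\<^sub>R x))) (at x)"
    using smooth_GDERIV[OF assms] unfolding gderiv_def
    by (intro has_derivative_compose[where g = f and f = "\<lambda>x. b + a *\<^sub>R x"])
      (auto intro!: derivative_eq_intros)
  then show "GDERIV (\<lambda>x. f (b + a *\<^sub>R x)) x :> a *\<^sub>R gradient f (b + a *\<^sub>R x)"
    by (simp add: gderiv_def)
qed

lemma gradient_compose:
  assumes "smooth f" "(g has_real_derivative d) (at (f x))"
  shows "gradient (\<lambda>x. g (f x)) x = d *\<^sub>R gradient f x"
  by (rule gradient_eqI[OF GDERIV_DERIV_compose[OF smooth_GDERIV[OF assms(1)] assms(2)]])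

section \<open>Smooth cut-offs\<close>

text \<open>The classical flat function exp(-1/t), with negative powers of t carried along: the span
  of this family is closed under differentiation, so smoothness becomes an induction on the order
  that is uniform in n.\<close>

definition flat :: "nat \<Rightarrow> real \<Rightarrow> real" where
  "flat n t = (if 0 < t then exp (- inverse t) * inverse t ^ n else 0)"

lemma flat_has_derivative:
  "(flat n has_real_derivative flat (n + 2) t - real n * flat (Suc n) t) (at t)"
proof -
  consider "t < 0" | "t = 0" | "0 < t" by linarith
  then show ?thesis
  proof cases
    case 1
    have "((\<lambda>t. 0) has_real_derivative 0) (at t)" by simp
    then have "(flat n has_real_derivative 0) (at t)"
      by (rule has_field_derivative_transform_within_open[where S = "{..<0}"])
        (use 1 in \<open>auto simp: flat_def\<close>)
    then show ?thesis using 1 by (simp add: flat_def)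
  next
    case 2
    \<comment> \<open>With x = 1/h, the right difference quotient at 0, \<open>flat n h / h\<close>,
      takes this form.\<close>
    have "((\<lambda>x::real. x ^ Suc n / exp x) \<longlongrightarrow> 0) at_top"
      by (rule tendsto_power_div_exp_0)
    then have "((\<lambda>t::real. inverse t ^ Suc n / exp (inverse t)) \<longlongrightarrow> 0) (at_right 0)"
      by (rule filterlim_compose[OF _ filterlim_inverse_at_top_right])
    then have "((\<lambda>h. flat n h / h) \<longlongrightarrow> 0) (at_right 0)"
      by (rule Lim_transform_eventually)
        (auto simp: eventually_at_right_field flat_def exp_minus field_simps intro!: exI[of _ 1])
    moreover have "((\<lambda>h. flat n h / h) \<longlongrightarrow> 0) (at_left 0)"
      by (rule Lim_transform_eventually[OF tendsto_const])
        (auto simp: eventually_at_left_field flat_def intro!: exI[of _ "-1"])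
    ultimately have "((\<lambda>h. flat n h / h) \<longlongrightarrow> 0) (at 0)"
      by (simp add: filterlim_at_split)
    then show ?thesis
      using 2 by (simp add: DERIV_def flat_def)
  next
    case 3
    have "((\<lambda>t. exp (- inverse t) * inverse t ^ n) has_real_derivative
        exp (- inverse t) * (inverse t ^ 2) * inverse t ^ n
        + (real n * inverse t ^ (n - 1) * - (inverse t ^ 2)) * exp (- inverse t)) (at t)"
    proof -
      have i: "(inverse has_real_derivative - (inverse t ^ 2)) (at t)"
        using DERIV_inverse[of t] 3 by (simp add: power2_eq_square)
      show ?thesis
        using DERIV_mult[OF DERIV_chain2[OF DERIV_exp DERIV_minus[OF i]] DERIV_power[OF i, of n]]
        by (simp add: algebra_simps)
    qed
    \<comment> \<open>For n = 0 the truncated exponent \<open>n - 1\<close> does no harm, since the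
      factor \<open>real n\<close> vanishes.\<close>
    moreover have eq: "real n * inverse t ^ (n - 1) * - (inverse t ^ 2) = - real n * inverse t ^ Suc n"
      by (cases n) (simp_all add: power2_eq_square algebra_simps)
    ultimately have "((\<lambda>t. exp (- inverse t) * inverse t ^ n) has_real_derivative
        flat (n + 2) t - real n * flat (Suc n) t) (at t)"
      unfolding eq using 3 by (simp add: flat_def power2_eq_square mult_ac)
    then show ?thesis
      by (rule has_field_derivative_transform_within_open[where S = "{0<..}"])
        (use 3 in \<open>auto simp: flat_def\<close>)
  qed
qed

lemma smooth_flat: "smooth (flat n)"
proof -
  have "C_k k (flat n)" for k
  proof (induction k arbitrary: n)
    case 0
    have "isCont (flat n) t" for t
      using flat_has_derivative by (rule DERIV_isCont)
    then show ?case by (simp add: continuous_on_eq_continuous_at)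
  next
    case (Suc k)
    have "(flat n has_derivative
        (\<lambda>v. (flat (n + 2) t + (- real n) * flat (Suc n) t) * v)) (at t)" for t
      using flat_has_derivative[of n t] by (simp add: has_field_derivative_def)
    then show ?case
      by (rule C_k_SucI) (intro C_k_mult C_k_add C_k_const Suc.IH)
  qed
  then show ?thesis by (simp add: smooth_def)
qed

lemma flat_0_mono: "s \<le> t \<Longrightarrow> flat 0 s \<le> flat 0 t"
  by (auto simp: flat_def intro!: le_imp_inverse_le)

lemma flat_0_nonneg: "0 \<le> flat 0 t"
  by (simp add: flat_def)

text \<open>At least one of t and 1 - t is positive. This makes the denominator of
  \<open>smooth_step\<close> nonzero everywhere.\<close>

lemma flat_0_sum_pos: "0 < flat 0 t + flat 0 (1 - t)"
  by (auto simp: flat_def add_pos_nonneg add_nonneg_pos)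

definition smooth_step :: "real \<Rightarrow> real" where
  "smooth_step t = flat 0 t * inverse (flat 0 t + flat 0 (1 - t))"

lemma smooth_smooth_step: "smooth smooth_step"
proof -
  have "smooth (\<lambda>t::real. flat 0 (1 - t))"
    using smooth_affine[OF smooth_flat, of 0 1 "-1"] by simp
  then show ?thesis
    unfolding smooth_step_def[abs_def]
    by (rule smooth_mult[OF smooth_flat smooth_inverse[OF smooth_add[OF smooth_flat]]])
      (simp_all add: flat_0_sum_pos less_imp_neq[symmetric])
qed

lemma smooth_step_nonneg: "0 \<le> smooth_step t"
  using flat_0_nonneg flat_0_sum_pos by (simp add: smooth_step_def less_imp_le)

lemma smooth_step_le_1: "smooth_step t \<le> 1"
  using flat_0_nonneg[of "1-t"] flat_0_sum_pos[of t]
  by (simp add: smooth_step_def field_simps)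

lemma smooth_step_0: "t \<le> 0 \<Longrightarrow> smooth_step t = 0"
  by (simp add: smooth_step_def flat_def)

lemma smooth_step_1: "1 \<le> t \<Longrightarrow> smooth_step t = 1"
  by (simp add: smooth_step_def flat_def)

lemma smooth_step_mono:
  assumes "s \<le> t" shows "smooth_step s \<le> smooth_step t"
proof -
  \<comment> \<open>This is the claim after cross-multiplication, the common product
    \<open>flat 0 s * flat 0 t\<close> having cancelled.\<close>
  have "flat 0 s * flat 0 (1 - t) \<le> flat 0 t * flat 0 (1 - s)"
    by (intro mult_mono flat_0_mono flat_0_nonneg) (use assms in auto)
  then show ?thesis
    unfolding smooth_step_def divide_inverse[symmetric]
    using flat_0_sum_pos[of s] flat_0_sum_pos[of t]
    by (simp add: divide_le_eq pos_le_divide_eq) (simp add: algebra_simps)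
qed

section \<open>Convexity of powers\<close>

text \<open>Convexity gives this on the open half-line; the endpoints are separate. At a = 0 the
  convention that \<open>0 powr x\<close> is 0 for every x, including x = 0, makes the left side 0
  even when p = 1.\<close>

lemma powr_above_tangent:
  fixes a b p :: real
  assumes "0 \<le> a" "0 \<le> b" "1 \<le> p"
  shows "a powr p + p * a powr (p - 1) * (b - a) \<le> b powr p"
proof -
  consider "a = 0" | "0 < a" "b = 0" | "0 < a" "0 < b" using assms by linarith
  then show ?thesis
  proof cases
    case 1
    then show ?thesis by simp
  next
    case 2
    have "a powr p = a * a powr (p - 1)"
      using 2 by (simp add: powr_mult_base)
    moreover have "1 * (a * a powr (p - 1)) \<le> p * (a * a powr (p - 1))"
      by (rule mult_right_mono) (use 2 assms in auto)
    ultimately show ?thesis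
      using 2 by (simp add: algebra_simps)
  next
    case 3
    have "b powr p - a powr p \<ge> (p * a powr (p - 1)) * (b - a)"
    proof (rule convex_on_imp_above_tangent[where A = "{0<..}"])
      show "convex_on {0<..} (\<lambda>x. x powr p)" by (rule powr_convex[OF assms(3)])
      show "((\<lambda>x. x powr p) has_real_derivative p * a powr (p - 1)) (at a within {0<..})"
        by (rule has_field_derivative_at_within[OF has_real_derivative_powr[OF 3(1)]])
    qed (use 3 in \<open>auto simp: interior_open\<close>)
    then show ?thesis by linarith
  qed
qed

text \<open>Average the tangent inequalities at the mean of a and b: the linear terms
  cancel.\<close>

lemma powr_convex_combination:
  fixes a b p t :: real
  assumes "0 \<le> a" "0 \<le> b" "1 \<le> p" "0 \<le> t" "t \<le> 1"
  shows "((1 - t) * a + t * b) powr p \<le> (1 - t) * a powr p + t * b powr p"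
proof -
  define A where "A = (1 - t) * a + t * b"
  have "0 \<le> A" using assms by (simp add: A_def)
  then have "(1 - t) * (A powr p + p * A powr (p - 1) * (a - A)) \<le> (1 - t) * a powr p"
    "t * (A powr p + p * A powr (p - 1) * (b - A)) \<le> t * b powr p"
    using assms by (auto intro!: mult_left_mono powr_above_tangent)
  moreover have "(1 - t) * (A powr p + p * A powr (p - 1) * (a - A))
      + t * (A powr p + p * A powr (p - 1) * (b - A))
      = A powr p + p * A powr (p - 1) * (((1 - t) * a + t * b) - A)"
    by algebra
  ultimately show ?thesis by (simp add: A_def)
qed

text \<open>Convexity applied to a/(1-t) and b/t. As t tends to 0 the factor of
  \<open>a powr p\<close> tends to 1, and the price is paid only by b, which will be the error
  term.\<close>

lemma powr_add_le:
  fixes a b p t :: real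
  assumes "0 \<le> a" "0 \<le> b" "1 \<le> p" "0 < t" "t < 1"
  shows "(a + b) powr p \<le> (1 - t) powr (1 - p) * a powr p + t powr (1 - p) * b powr p"
proof -
  have eq: "s * (c / s) powr p = s powr (1 - p) * c powr p" if "0 < s" "0 \<le> c" for s c :: real
    using that by (simp add: powr_divide powr_diff)
  have "(a + b) powr p = ((1 - t) * (a / (1 - t)) + t * (b / t)) powr p"
    using assms by simp
  also have "\<dots> \<le> (1 - t) * (a / (1 - t)) powr p + t * (b / t) powr p"
    by (rule powr_convex_combination) (use assms in auto)
  also have "\<dots> = (1 - t) powr (1 - p) * a powr p + t powr (1 - p) * b powr p"
    using assms by (simp only: eq diff_gt_0_iff_gt)
  finally show ?thesis .
qed

lemma powr_add_le_2:
  fixes a b p :: real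
  assumes "0 \<le> a" "0 \<le> b" "1 \<le> p"
  shows "(a + b) powr p \<le> 2 powr (p - 1) * (a powr p + b powr p)"
proof -
  have "(1/2::real) powr (1 - p) = 2 powr (p - 1)"
    by (simp add: powr_divide powr_minus_divide[symmetric])
  then show ?thesis
    using powr_add_le[OF assms, of "1/2"] by (simp add: distrib_left)
qed

section \<open>Test functions, energies and capacities\<close>

text \<open>Whole-space integrals, for which translations and dilations need no bookkeeping of
  domains. On test functions they agree with the integrals over the domain, by extension by
  zero.\<close>

definition energy :: "real \<Rightarrow> ('a::euclidean_space \<Rightarrow> real) \<Rightarrow> ennreal" where
  "energy p f = (\<integral>\<^sup>+x. ennreal (norm (gradient f x) powr p) \<partial>lborel)"

definition mass :: "real \<Rightarrow> ('a::euclidean_space \<Rightarrow> real) \<Rightarrow> ennreal" where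
  "mass p f = (\<integral>\<^sup>+x. ennreal (\<bar>f x\<bar> powr p) \<partial>lborel)"

lemma test_functions_smooth: "f \<in> test_functions \<Omega> \<Longrightarrow> smooth f"
  by (simp add: test_functions_def)

lemma test_functionsI:
  assumes "smooth f" "compact K" "K \<subseteq> \<Omega>" "\<And>x. x \<notin> K \<Longrightarrow> f x = 0"
  shows "f \<in> test_functions \<Omega>"
proof -
  have "closure {x. f x \<noteq> 0} \<subseteq> K"
    using assms by (intro closure_minimal compact_imp_closed) auto
  moreover from this have "compact (closure {x. f x \<noteq> 0})"
    using assms(2) compact_imp_bounded bounded_subset compact_eq_bounded_closed closed_closure by blast
  ultimately show ?thesis
    using assms by (auto simp: test_functions_def)
qed

text \<open>One compact set serves the function and its gradient: off the closed support the
  function vanishes on an open set, so its gradient vanishes there too.\<close>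

lemma test_functions_support:
  assumes "f \<in> test_functions \<Omega>"
  shows "\<exists>K. compact K \<and> K \<subseteq> \<Omega> \<and> (\<forall>x. x \<notin> K \<longrightarrow> f x = 0) \<and> (\<forall>x. x \<notin> K \<longrightarrow> gradient f x = 0)"
proof (intro exI conjI allI impI)
  let ?K = "closure {x. f x \<noteq> 0}"
  show "compact ?K" "?K \<subseteq> \<Omega>"
    using assms by (simp_all add: test_functions_def)
  have 0: "f x = 0" if "x \<notin> ?K" for x
    using that closure_subset[of "{x. f x \<noteq> 0}"] by blast
  then show "f x = 0" if "x \<notin> ?K" for x
    using that .
  show "gradient f x = 0" if "x \<notin> ?K" for x
  proof (rule gradient_eqI)
    have "((\<lambda>x. 0) has_derivative (\<lambda>h. h \<bullet> 0)) (at x)" by simp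
    then show "GDERIV f x :> 0" unfolding gderiv_def
    proof (rule has_derivative_transform_within_open[where s = "- ?K"])
      show "x \<in> - ?K" by (rule ComplI) (rule notE[OF that])
      show "0 = f y" if "y \<in> - ?K" for y
        by (rule 0[OF ComplD[OF that], symmetric])
    qed (rule open_Compl[OF closed_closure])
  qed
qed

lemma test_functions_mono: "f \<in> test_functions A \<Longrightarrow> A \<subseteq> B \<Longrightarrow> f \<in> test_functions B"
  by (auto simp: test_functions_def)

lemma test_functions_0: "f \<in> test_functions \<Omega> \<Longrightarrow> x \<notin> \<Omega> \<Longrightarrow> f x = 0"
  using test_functions_support[of f \<Omega>] by auto

lemma test_functions_mult:
  assumes "f \<in> test_functions \<Omega>" "smooth g"
  shows "(\<lambda>x. f x * g x) \<in> test_functions \<Omega>"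
proof -
  obtain K where K: "compact K" "K \<subseteq> \<Omega>" "\<And>x. x \<notin> K \<Longrightarrow> f x = 0"
    using test_functions_support[OF assms(1)] by auto
  then show ?thesis
    by (intro test_functionsI[OF smooth_mult[OF test_functions_smooth[OF assms(1)] assms(2)] K(1,2)]) auto
qed

lemma test_functions_add:
  assumes "f \<in> test_functions \<Omega>" "g \<in> test_functions \<Omega>"
  shows "(\<lambda>x. f x + g x) \<in> test_functions \<Omega>"
proof -
  obtain K where K: "compact K" "K \<subseteq> \<Omega>" "\<And>x. x \<notin> K \<Longrightarrow> f x = 0"
    using test_functions_support[OF assms(1)] by auto
  obtain L where L: "compact L" "L \<subseteq> \<Omega>" "\<And>x. x \<notin> L \<Longrightarrow> g x = 0"
    using test_functions_support[OF assms(2)] by auto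
  show ?thesis
    by (rule test_functionsI[OF smooth_add compact_Un[OF K(1) L(1)]])
      (use assms K L in \<open>auto intro: test_functions_smooth\<close>)
qed

lemma test_functions_affine:
  assumes "f \<in> test_functions \<Omega>" "a \<noteq> 0"
  shows "(\<lambda>x. f (b + a *\<^sub>R x)) \<in> test_functions {x. b + a *\<^sub>R x \<in> \<Omega>}"
proof -
  obtain K where K: "compact K" "K \<subseteq> \<Omega>" "\<And>x. x \<notin> K \<Longrightarrow> f x = 0"
    using test_functions_support[OF assms(1)] by auto
  have inv: "b + a *\<^sub>R ((1 / a) *\<^sub>R (y - b)) = y" for y
    using assms(2) by simp
  show ?thesis
  proof (rule test_functionsI)
    show "compact ((\<lambda>y. (1 / a) *\<^sub>R (y - b)) ` K)"
      by (intro compact_continuous_image continuous_intros K(1))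
    show "(\<lambda>y. (1 / a) *\<^sub>R (y - b)) ` K \<subseteq> {x. b + a *\<^sub>R x \<in> \<Omega>}"
      using K(2) inv by auto
    show "f (b + a *\<^sub>R x) = 0" if "x \<notin> (\<lambda>y. (1 / a) *\<^sub>R (y - b)) ` K" for x
    proof (rule K(3), rule notI)
      assume "b + a *\<^sub>R x \<in> K"
      moreover have "x = (1 / a) *\<^sub>R ((b + a *\<^sub>R x) - b)" using assms(2) by simp
      ultimately show False using that by blast
    qed
  qed (intro smooth_affine test_functions_smooth[OF assms(1)])
qed

lemma measurable_norm_gradient [measurable]:
  assumes "smooth f"
  shows "(\<lambda>x. norm (gradient f x)) \<in> borel_measurable borel"
  by (intro borel_measurable_continuous_onI continuous_intros continuous_on_gradient assms)

lemma measurable_smooth: "smooth f \<Longrightarrow> f \<in> borel_measurable borel"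
  by (intro borel_measurable_continuous_onI smooth_continuous_on)

lemma dirichlet_energy_eq_energy:
  assumes "f \<in> test_functions \<Omega>"
  shows "dirichlet_energy p \<Omega> f = energy p f"
proof -
  obtain K where "K \<subseteq> \<Omega>" "\<And>x. x \<notin> K \<Longrightarrow> gradient f x = 0"
    using test_functions_support[OF assms(1)] by auto
  then show ?thesis
    unfolding dirichlet_energy_def energy_def
    by (intro nn_integral_cong) (auto simp: indicator_def)
qed

lemma Lp_norm_eq_1_iff:
  assumes "f \<in> test_functions \<Omega>" "1 \<le> p"
  shows "Lp_norm p \<Omega> f = 1 \<longleftrightarrow> mass p f = 1"
proof -
  have "(\<integral>\<^sup>+x\<in>\<Omega>. ennreal (\<bar>f x\<bar> powr p) \<partial>lborel) = mass p f"
    unfolding mass_def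
    by (intro nn_integral_cong) (auto simp: indicator_def test_functions_0[OF assms(1)])
  moreover have "epowr m (1 / p) = 1 \<longleftrightarrow> m = 1" for m
  proof (cases m)
    case (real r)
    have "r powr (1 / p) = 1 \<longleftrightarrow> r = 1"
    proof
      assume "r powr (1 / p) = 1"
      then have "(r powr (1 / p)) powr p = 1" by simp
      then show "r = 1" using assms(2) real by (simp add: powr_powr)
    qed simp
    then show ?thesis using real by (simp add: epowr_def)
  qed (simp add: epowr_def)
  ultimately show ?thesis by (simp add: Lp_norm_def)
qed

lemma nn_integral_compact_support_finite:
  fixes g :: "'a::euclidean_space \<Rightarrow> real"
  assumes "compact K" "continuous_on UNIV g" "\<And>x. x \<notin> K \<Longrightarrow> g x = 0"
  shows "(\<integral>\<^sup>+x. ennreal (g x) \<partial>lborel) < \<infinity>"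
proof -
  have "bounded (g ` K)"
    by (intro compact_imp_bounded compact_continuous_image assms continuous_on_subset[OF assms(2)]) simp
  then obtain C where C: "\<And>x. x \<in> K \<Longrightarrow> \<bar>g x\<bar> \<le> C"
    by (auto simp: bounded_iff)
  have "(\<integral>\<^sup>+x. ennreal (g x) \<partial>lborel) \<le> (\<integral>\<^sup>+x. ennreal C * indicator K x \<partial>lborel)"
    by (intro nn_integral_mono) (use C assms(3) in \<open>force simp: indicator_def intro!: ennreal_leI\<close>)
  also have "\<dots> = ennreal C * emeasure lborel K"
    using assms(1) by (simp add: nn_integral_cmult_indicator compact_imp_closed)
  also have "\<dots> < \<infinity>"
    using emeasure_bounded_finite[OF compact_imp_bounded[OF assms(1)]]
    by (simp add: ennreal_mult_less_top)
  finally show ?thesis .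
qed

lemma continuous_on_powr_nonneg:
  fixes h :: "'a::topological_space \<Rightarrow> real"
  assumes "continuous_on S h" "\<And>x. 0 \<le> h x" "1 \<le> p"
  shows "continuous_on S (\<lambda>x. h x powr p)"
  by (rule continuous_on_powr') (use assms in auto)

lemma energy_finite:
  assumes "f \<in> test_functions \<Omega>" "1 \<le> p"
  shows "energy p f < \<infinity>"
proof -
  obtain K where K: "compact K" "\<And>x. x \<notin> K \<Longrightarrow> gradient f x = 0"
    using test_functions_support[OF assms(1)] by auto
  show ?thesis unfolding energy_def
    by (rule nn_integral_compact_support_finite[OF K(1)])
      (use assms K in \<open>auto intro!: continuous_on_powr_nonneg continuous_on_norm
        continuous_on_gradient test_functions_smooth[OF assms(1)]\<close>)
qed

lemma mass_finite:
  assumes "f \<in> test_functions \<Omega>" "1 \<le> p"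
  shows "mass p f < \<infinity>"
proof -
  obtain K where K: "compact K" "\<And>x. x \<notin> K \<Longrightarrow> f x = 0"
    using test_functions_support[OF assms(1)] by auto
  show ?thesis unfolding mass_def
    by (rule nn_integral_compact_support_finite[OF K(1)])
      (use assms K in \<open>auto intro!: continuous_on_powr_nonneg continuous_on_rabs
        smooth_continuous_on[OF test_functions_smooth[OF assms(1)]]\<close>)
qed

lemma gradient_bounded:
  assumes "f \<in> test_functions \<Omega>"
  obtains M where "0 < M" "\<And>x. norm (gradient f x) \<le> M"
proof -
  obtain K where K: "compact K" "\<And>x. x \<notin> K \<Longrightarrow> gradient f x = 0"
    using test_functions_support[OF assms(1)] by auto
  have "bounded (gradient f ` K)"
    by (intro compact_imp_bounded compact_continuous_image K
        continuous_on_subset[OF continuous_on_gradient] test_functions_smooth[OF assms]) simp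
  then obtain C where C: "0 < C" "\<And>x. x \<in> K \<Longrightarrow> norm (gradient f x) \<le> C"
    by (auto simp: bounded_pos)
  have "norm (gradient f x) \<le> C" for x
    using C K by (cases "x \<in> K") auto
  then show ?thesis using that C by blast
qed

section \<open>Scaling and homogeneity of energy and mass\<close>

lemma nn_integral_lborel_affine:
  fixes f :: "'a::euclidean_space \<Rightarrow> ennreal"
  assumes [measurable]: "f \<in> borel_measurable borel" and "c \<noteq> 0"
  shows "(\<integral>\<^sup>+x. f x \<partial>lborel) = ennreal (\<bar>c\<bar> ^ DIM('a)) * (\<integral>\<^sup>+x. f (t + c *\<^sub>R x) \<partial>lborel)"
  by (subst lborel_affine[OF assms(2), of t])
    (simp add: nn_integral_density nn_integral_distr nn_integral_cmult)

lemma energy_affine: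
  fixes f :: "'a::euclidean_space \<Rightarrow> real"
  assumes "smooth f" "a \<noteq> 0"
  shows "ennreal (\<bar>a\<bar> ^ DIM('a)) * energy p (\<lambda>x. f (b + a *\<^sub>R x)) = ennreal (\<bar>a\<bar> powr p) * energy p f"
proof -
  note [measurable] = measurable_norm_gradient[OF assms(1)]
  have "ennreal (norm (gradient (\<lambda>x. f (b + a *\<^sub>R x)) x) powr p)
      = ennreal (\<bar>a\<bar> powr p) * ennreal (norm (gradient f (b + a *\<^sub>R x)) powr p)" for x
    by (simp add: gradient_affine[OF assms(1)] powr_mult ennreal_mult')
  then have "energy p (\<lambda>x. f (b + a *\<^sub>R x))
      = ennreal (\<bar>a\<bar> powr p) * (\<integral>\<^sup>+x. ennreal (norm (gradient f (b + a *\<^sub>R x)) powr p) \<partial>lborel)"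
    by (simp add: energy_def nn_integral_cmult)
  moreover have "energy p f
      = ennreal (\<bar>a\<bar> ^ DIM('a)) * (\<integral>\<^sup>+x. ennreal (norm (gradient f (b + a *\<^sub>R x)) powr p) \<partial>lborel)"
    unfolding energy_def by (rule nn_integral_lborel_affine[OF _ assms(2)]) measurable
  ultimately show ?thesis by (simp add: ac_simps)
qed

lemma mass_affine:
  fixes f :: "'a::euclidean_space \<Rightarrow> real"
  assumes "smooth f" "a \<noteq> 0"
  shows "ennreal (\<bar>a\<bar> ^ DIM('a)) * mass p (\<lambda>x. f (b + a *\<^sub>R x)) = mass p f"
  unfolding mass_def using measurable_smooth[OF assms(1)]
  by (intro nn_integral_lborel_affine[OF _ assms(2), symmetric]) measurable

lemma energy_cmult:
  assumes "smooth f"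
  shows "energy p (\<lambda>x. c * f x) = ennreal (\<bar>c\<bar> powr p) * energy p f"
proof -
  note [measurable] = measurable_norm_gradient[OF assms(1)]
  show ?thesis
    unfolding energy_def gradient_cmult[OF assms]
    by (simp add: powr_mult ennreal_mult' nn_integral_cmult)
qed

lemma mass_cmult:
  assumes "smooth f"
  shows "mass p (\<lambda>x. c * f x) = ennreal (\<bar>c\<bar> powr p) * mass p f"
proof -
  note [measurable] = measurable_smooth[OF assms(1)]
  show ?thesis
    unfolding mass_def by (simp add: powr_mult abs_mult ennreal_mult' nn_integral_cmult)
qed

section \<open>Capacity and Poincare constant as infima\<close>

lemma capacity_le_energy:
  assumes "f \<in> test_functions E" "\<And>x. x \<in> \<Sigma> \<Longrightarrow> 1 \<le> f x"
  shows "capacity p \<Sigma> E \<le> energy p f"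
  unfolding capacity_def using assms
  by (intro Inf_lower) (auto simp: dirichlet_energy_eq_energy intro!: exI[of _ f])

lemma capacity_lessE:
  assumes "capacity p \<Sigma> E < c"
  obtains f where "f \<in> test_functions E" "\<And>x. x \<in> \<Sigma> \<Longrightarrow> 1 \<le> f x" "energy p f < c"
  using assms unfolding capacity_def Inf_less_iff
  by (auto simp: dirichlet_energy_eq_energy)

lemma capacity_greatest:
  assumes "\<And>f. f \<in> test_functions E \<Longrightarrow> (\<And>x. x \<in> \<Sigma> \<Longrightarrow> 1 \<le> f x) \<Longrightarrow> c \<le> energy p f"
  shows "c \<le> capacity p \<Sigma> E"
  unfolding capacity_def using assms
  by (intro Inf_greatest) (auto simp: dirichlet_energy_eq_energy)

lemma poincare_const_greatest:
  assumes "1 \<le> p" "\<And>f. f \<in> test_functions \<Omega> \<Longrightarrow> c * mass p f \<le> energy p f"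
  shows "c \<le> poincare_const p \<Omega>"
  unfolding poincare_const_def using assms
  by (intro Inf_greatest) (force simp: dirichlet_energy_eq_energy Lp_norm_eq_1_iff)

text \<open>Homogeneity removes the normalisation. If the mass is 0 the left side is 0 even for an
  infinite constant, since 0 times infinity is 0 in \<open>ennreal\<close>.\<close>

lemma poincare_const_mass_le:
  assumes f: "f \<in> test_functions \<Omega>" and p: "1 \<le> p"
  shows "poincare_const p \<Omega> * mass p f \<le> energy p f"
proof (cases "mass p f = 0")
  case False
  then obtain m where m: "mass p f = ennreal m" "0 < m"
    using mass_finite[OF f p] by (cases "mass p f") (auto simp: less_le)
  define c where "c = m powr (- 1 / p)"
  have sm: "smooth f" by (rule test_functions_smooth[OF f])
  have c: "\<bar>c\<bar> powr p = 1 / m"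
    using m p by (simp only: c_def abs_of_nonneg[OF powr_ge_zero] powr_powr) (simp add: powr_minus_divide)
  let ?g = "\<lambda>x. c * f x"
  have g: "?g \<in> test_functions \<Omega>"
    using test_functions_mult[OF f smooth_const[of c]] by (simp add: mult.commute)
  have "mass p ?g = 1"
    using m by (simp add: mass_cmult[OF sm] c ennreal_mult[symmetric])
  then have "poincare_const p \<Omega> \<le> energy p ?g"
    unfolding poincare_const_def using g p
    by (intro Inf_lower) (auto simp: dirichlet_energy_eq_energy Lp_norm_eq_1_iff intro!: exI[of _ ?g])
  then have "poincare_const p \<Omega> * mass p f \<le> ennreal (1 / m) * energy p f * ennreal m"
    unfolding m(1) by (intro mult_right_mono) (auto simp: energy_cmult[OF sm] c)
  also have "\<dots> = ennreal (1 / m * m) * energy p f"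
    using m by (simp only: ennreal_mult ac_simps less_imp_le divide_nonneg_pos zero_le_one)
  finally show ?thesis using m by simp
qed simp

section \<open>Difference quotients along segments\<close>

text \<open>The fundamental theorem of calculus along the segment, followed by Jensen's inequality
  on the unit interval.\<close>

lemma powr_diff_le_segment_integral:
  assumes u: "smooth u" and p: "1 \<le> p"
  shows "ennreal (\<bar>u y - u x\<bar> powr p)
    \<le> ennreal (norm (y - x) powr p) *
      (\<integral>\<^sup>+t\<in>{0..1}. ennreal (norm (gradient u (x + t *\<^sub>R (y - x))) powr p) \<partial>lborel)"
proof -
  define d where "d = y - x"
  define h where "h t = norm d * norm (gradient u (x + t *\<^sub>R d))" for t :: real
  define D where "D = \<bar>u y - u x\<bar>"
  have cg: "continuous_on S (\<lambda>t. gradient u (x + t *\<^sub>R d))" for S :: "real set"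
    by (rule continuous_on_compose2[OF continuous_on_gradient[OF u]]) (auto intro!: continuous_intros)
  have ch: "continuous_on S h" for S
    unfolding h_def by (intro continuous_intros cg)
  have h0: "0 \<le> h t" for t by (simp add: h_def)
  have chp: "continuous_on S (\<lambda>t. h t powr p)" for S
    by (rule continuous_on_powr_nonneg[OF ch h0 p])
  have "((\<lambda>t. u (x + t *\<^sub>R d)) has_vector_derivative d \<bullet> gradient u (x + t *\<^sub>R d)) (at t within {0..1})" for t
  proof -
    have "((\<lambda>t. u (x + t *\<^sub>R d)) has_derivative (\<lambda>s. (s *\<^sub>R d) \<bullet> gradient u (x + t *\<^sub>R d))) (at t)"
      by (rule has_derivative_compose[where g = u and f = "\<lambda>t. x + t *\<^sub>R d",
            OF _ smooth_GDERIV[OF u, unfolded gderiv_def]])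
        (auto intro!: derivative_eq_intros)
    then show ?thesis
      unfolding has_vector_derivative_def
      by (rule has_derivative_at_withinI[THEN has_derivative_eq_rhs]) simp
  qed
  then have "((\<lambda>t. d \<bullet> gradient u (x + t *\<^sub>R d)) has_integral (u (x + 1 *\<^sub>R d) - u (x + 0 *\<^sub>R d))) {0..1}"
    by (rule fundamental_theorem_of_calculus[rotated]) simp
  then have I: "integral {0..1} (\<lambda>t. d \<bullet> gradient u (x + t *\<^sub>R d)) = u y - u x"
    by (simp add: d_def integral_unique)
  have "norm (integral {0..1} (\<lambda>t. d \<bullet> gradient u (x + t *\<^sub>R d))) \<le> integral {0..1} h"
    by (rule integral_norm_bound_integral)
      (auto intro!: integrable_continuous_real continuous_intros cg ch
        simp: h_def Cauchy_Schwarz_ineq2)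
  then have D: "D \<le> integral {0..1} h" by (simp add: I D_def)
  \<comment> \<open>\<open>?k\<close> is the slope at D of the power function. Jensen is obtained
    with the tangent at D rather than at the mean of h; as D is at most that mean, the added linear
    term is nonnegative.\<close>
  let ?k = "p * D powr (p - 1)"
  have "D powr p \<le> D powr p + ?k * (integral {0..1} h - D)"
    using D p by simp
  also have "\<dots> = integral {0..1} (\<lambda>t. D powr p + ?k * (h t - D))"
  proof (rule integral_unique[symmetric])
    have h1: "(h has_integral integral {0..1} h) {0..1}"
      by (rule integrable_integral[OF integrable_continuous_real[OF ch]])
    have c1: "((\<lambda>t. c) has_integral c) {0..1::real}" for c :: real
      using has_integral_const_real[of c 0 1] by simp
    show "((\<lambda>t. D powr p + ?k * (h t - D)) has_integral
        (D powr p + ?k * (integral {0..1} h - D))) {0..1}"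
      by (rule has_integral_add[OF c1 has_integral_mult_right[OF has_integral_diff[OF h1 c1]]])
  qed
  also have "\<dots> \<le> integral {0..1} (\<lambda>t. h t powr p)"
  proof (rule integral_le)
    show "(\<lambda>t. D powr p + ?k * (h t - D)) integrable_on {0..1}"
      by (rule integrable_continuous_real) (intro continuous_intros ch)
    show "(\<lambda>t. h t powr p) integrable_on {0..1}"
      by (rule integrable_continuous_real[OF chp])
    show "D powr p + ?k * (h t - D) \<le> h t powr p" for t
      by (rule powr_above_tangent[OF _ h0 p]) (simp add: D_def)
  qed
  finally have *: "D powr p \<le> integral {0..1} (\<lambda>t. h t powr p)" .
  have "ennreal (D powr p) \<le> ennreal (integral {0..1} (\<lambda>t. h t powr p))"
    by (rule ennreal_leI[OF *])
  also have "\<dots> = (\<integral>\<^sup>+t\<in>{0..1}. ennreal (h t powr p) \<partial>lborel)"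
    by (rule nn_integral_has_integral_lebesgue'[symmetric])
      (auto intro!: integrable_integral integrable_continuous_real chp)
  also have "\<dots> = (\<integral>\<^sup>+t. ennreal (norm d powr p) *
      (ennreal (norm (gradient u (x + t *\<^sub>R d)) powr p) * indicator {0..1} t) \<partial>lborel)"
    by (simp add: h_def powr_mult ennreal_mult' mult.assoc)
  also have "\<dots> = ennreal (norm d powr p) *
      (\<integral>\<^sup>+t\<in>{0..1}. ennreal (norm (gradient u (x + t *\<^sub>R d)) powr p) \<partial>lborel)"
  proof (rule nn_integral_cmult)
    have [measurable]: "(\<lambda>t. norm (gradient u (x + t *\<^sub>R d)) powr p) \<in> borel_measurable borel"
      by (intro borel_measurable_continuous_onI continuous_on_powr_nonneg continuous_intros cg p) auto
    show "(\<lambda>t. ennreal (norm (gradient u (x + t *\<^sub>R d)) powr p) * indicator {0..1} t)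
        \<in> borel_measurable lborel" by measurable
  qed
  finally show ?thesis by (simp add: D_def d_def)
qed

text \<open>The segment from \<open>x\<close> to \<open>h + a x\<close> runs through the affine images
  \<open>t h + (1 - t + t a) x\<close>; for \<open>a = 1\<close> these are translations, for \<open>h = 0\<close> dilations.\<close>

lemma affine_difference_le_energy:
  fixes u :: "'a::euclidean_space \<Rightarrow> real"
  assumes u: "smooth u" and p: "1 \<le> p" and a: "0 < a" "a \<le> 1" and S[measurable]: "S \<in> sets borel"
    and L: "\<And>x. x \<in> S \<Longrightarrow> norm (h + a *\<^sub>R x - x) \<le> L" and "0 \<le> L"
  shows "(\<integral>\<^sup>+x\<in>S. ennreal (\<bar>u (h + a *\<^sub>R x) - u x\<bar> powr p) \<partial>lborel)
    \<le> ennreal (L powr p / a ^ DIM('a)) * energy p u"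
proof -
  note [measurable] = measurable_norm_gradient[OF u] measurable_smooth[OF u]
  let ?G = "\<lambda>x. ennreal (norm (gradient u x) powr p)"
  let ?T = "\<lambda>t x. t *\<^sub>R h + (1 - t + t * a) *\<^sub>R x"
  have seg: "x + t *\<^sub>R (h + a *\<^sub>R x - x) = ?T t x" for x t
    by (simp add: algebra_simps)
  have "(\<integral>\<^sup>+x\<in>S. ennreal (\<bar>u (h + a *\<^sub>R x) - u x\<bar> powr p) \<partial>lborel)
      \<le> (\<integral>\<^sup>+x. ennreal (L powr p) * (\<integral>\<^sup>+t\<in>{0..1}. ?G (?T t x) \<partial>lborel) \<partial>lborel)"
  proof (rule nn_integral_mono)
    fix x
    show "ennreal (\<bar>u (h + a *\<^sub>R x) - u x\<bar> powr p) * indicator S x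
        \<le> ennreal (L powr p) * (\<integral>\<^sup>+t\<in>{0..1}. ?G (?T t x) \<partial>lborel)"
    proof (cases "x \<in> S")
      case True
      have "ennreal (\<bar>u (h + a *\<^sub>R x) - u x\<bar> powr p)
          \<le> ennreal (norm (h + a *\<^sub>R x - x) powr p) * (\<integral>\<^sup>+t\<in>{0..1}. ?G (?T t x) \<partial>lborel)"
        using powr_diff_le_segment_integral[OF u p, of "h + a *\<^sub>R x" x] by (simp only: seg)
      also have "\<dots> \<le> ennreal (L powr p) * (\<integral>\<^sup>+t\<in>{0..1}. ?G (?T t x) \<partial>lborel)"
        using L[OF True] p by (intro mult_right_mono ennreal_leI powr_mono2) auto
      finally show ?thesis using True by simp
    qed simp
  qed
  also have "\<dots> = ennreal (L powr p) * (\<integral>\<^sup>+x. (\<integral>\<^sup>+t\<in>{0..1}. ?G (?T t x) \<partial>lborel) \<partial>lborel)"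
    by (rule nn_integral_cmult) measurable
  also have "(\<integral>\<^sup>+x. (\<integral>\<^sup>+t\<in>{0..1}. ?G (?T t x) \<partial>lborel) \<partial>lborel)
      = (\<integral>\<^sup>+t. (\<integral>\<^sup>+x. ?G (?T t x) * indicator {0..1} t \<partial>lborel) \<partial>lborel)"
    by (rule lborel_pair.Fubini') measurable
  also have "\<dots> \<le> (\<integral>\<^sup>+t. ennreal (1 / a ^ DIM('a)) * energy p u * indicator {0..1::real} t \<partial>lborel)"
  proof (rule nn_integral_mono)
    fix t :: real
    show "(\<integral>\<^sup>+x. ?G (?T t x) * indicator {0..1} t \<partial>lborel)
        \<le> ennreal (1 / a ^ DIM('a)) * energy p u * indicator {0..1::real} t"
    proof (cases "t \<in> {0..1}")
      case True
      \<comment> \<open>The dilation factor of the intermediate map at time t. It never drops below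
        a, so the change of variables costs at most \<open>1 / a ^ DIM('a)\<close>, uniformly in
        t.\<close>
      define c where "c = 1 - t + t * a"
      have "t * (1 - a) \<le> 1 * (1 - a)"
        by (rule mult_right_mono) (use True a in auto)
      then have c: "a \<le> c" unfolding c_def by (simp add: algebra_simps)
      then have "0 < c" using a by linarith
      have "energy p u = ennreal (c ^ DIM('a)) * (\<integral>\<^sup>+x. ?G (?T t x) \<partial>lborel)"
        using nn_integral_lborel_affine[of ?G c "t *\<^sub>R h"] \<open>0 < c\<close>
        by (simp add: energy_def c_def)
      moreover have "ennreal (a ^ DIM('a)) \<le> ennreal (c ^ DIM('a))"
        using a c by (intro ennreal_leI power_mono) auto
      ultimately have "ennreal (a ^ DIM('a)) * (\<integral>\<^sup>+x. ?G (?T t x) \<partial>lborel) \<le> energy p u"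
        by (simp add: mult_right_mono)
      then have "ennreal (1 / a ^ DIM('a)) * (ennreal (a ^ DIM('a)) * (\<integral>\<^sup>+x. ?G (?T t x) \<partial>lborel))
          \<le> ennreal (1 / a ^ DIM('a)) * energy p u"
        by (rule mult_left_mono) simp
      moreover have "ennreal (1 / a ^ DIM('a)) * ennreal (a ^ DIM('a)) = 1"
        using a by (simp add: ennreal_mult[symmetric])
      ultimately show ?thesis
        using True by (simp add: mult.assoc[symmetric])
    qed simp
  qed
  also have "\<dots> = ennreal (1 / a ^ DIM('a)) * energy p u"
    by (simp add: nn_integral_cmult_indicator)
  finally have "(\<integral>\<^sup>+x\<in>S. ennreal (\<bar>u (h + a *\<^sub>R x) - u x\<bar> powr p) \<partial>lborel)
      \<le> ennreal (L powr p) * (ennreal (1 / a ^ DIM('a)) * energy p u)"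
    by (simp add: mult_left_mono)
  also have "\<dots> = ennreal (L powr p / a ^ DIM('a)) * energy p u"
    using a by (simp add: mult.assoc[symmetric] ennreal_mult[symmetric])
  finally show ?thesis .
qed

lemma translation_difference_le_energy:
  fixes u :: "'a::euclidean_space \<Rightarrow> real"
  assumes "smooth u" "1 \<le> p"
  shows "(\<integral>\<^sup>+x. ennreal (\<bar>u (x + h) - u x\<bar> powr p) \<partial>lborel) \<le> ennreal (norm h powr p) * energy p u"
  using affine_difference_le_energy[OF assms, of 1 UNIV h "norm h"] by (simp add: add.commute)

text \<open>Translate by the diameter 2R: a point and its translate cannot both lie in the ball, so
  wherever u is nonzero its shifted value is 0 and the difference is u itself.\<close>

lemma mass_le_energy_ball:
  fixes u :: "'a::euclidean_space \<Rightarrow> real"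
  assumes u: "u \<in> test_functions (ball x0 R)" and p: "1 \<le> p" and "0 < R"
  shows "mass p u \<le> ennreal ((2 * R) powr p) * energy p u"
proof -
  obtain b :: 'a where "b \<in> Basis" using nonempty_Basis by blast
  define h where "h = (2 * R) *\<^sub>R b"
  have h: "norm h = 2 * R" using \<open>b \<in> Basis\<close> \<open>0 < R\<close> by (simp add: h_def)
  have "mass p u \<le> (\<integral>\<^sup>+x. ennreal (\<bar>u (x + h) - u x\<bar> powr p) \<partial>lborel)"
    unfolding mass_def
  proof (rule nn_integral_mono)
    fix x
    show "ennreal (\<bar>u x\<bar> powr p) \<le> ennreal (\<bar>u (x + h) - u x\<bar> powr p)"
    proof (cases "x \<in> ball x0 R")
      case True
      have "norm h \<le> dist x0 (x + h) + dist x0 x"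
        using norm_triangle_ineq4[of "x + h - x0" "x - x0"] by (simp add: dist_norm norm_minus_commute)
      then have "x + h \<notin> ball x0 R"
        using True h by auto
      then show ?thesis using test_functions_0[OF u] by simp
    next
      case False
      then show ?thesis using test_functions_0[OF u] p by simp
    qed
  qed
  also have "\<dots> \<le> ennreal (norm h powr p) * energy p u"
    by (rule translation_difference_le_energy[OF test_functions_smooth[OF u] p])
  finally show ?thesis by (simp add: h)
qed

text \<open>A competitor is at least 1 on the inner ball, so its mass is at least the volume of that
  ball. The Poincare inequality on the outer ball, of diameter 4r, turns this into energy.\<close>

lemma capacity_ball_ge:
  fixes x0 :: "'a::euclidean_space"
  assumes p: "1 \<le> p" and r: "0 < r"
  shows "ennreal (unit_ball_vol DIM('a) * r ^ DIM('a) / (4 * r) powr p)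
    \<le> capacity p (cball x0 r) (ball x0 (2 * r))"
proof (rule capacity_greatest)
  fix f :: "'a \<Rightarrow> real"
  assume f: "f \<in> test_functions (ball x0 (2 * r))" and 1: "\<And>x. x \<in> cball x0 r \<Longrightarrow> 1 \<le> f x"
  have "ennreal (unit_ball_vol DIM('a) * r ^ DIM('a)) = (\<integral>\<^sup>+x. indicator (cball x0 r) x \<partial>lborel)"
    using r by (simp add: emeasure_cball)
  also have "\<dots> \<le> mass p f"
    unfolding mass_def
  proof (rule nn_integral_mono)
    fix x
    show "indicator (cball x0 r) x \<le> ennreal (\<bar>f x\<bar> powr p)"
    proof (cases "x \<in> cball x0 r")
      case True
      then have "1 \<le> \<bar>f x\<bar> powr p" using 1[OF True] p by (intro ge_one_powr_ge_zero) auto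
      then show ?thesis using True by simp
    qed simp
  qed
  also have "\<dots> \<le> ennreal ((2 * (2 * r)) powr p) * energy p f"
    by (rule mass_le_energy_ball[OF f p]) (use r in simp)
  finally have "ennreal (1 / (4 * r) powr p) * ennreal (unit_ball_vol DIM('a) * r ^ DIM('a))
      \<le> ennreal (1 / (4 * r) powr p) * (ennreal ((4 * r) powr p) * energy p f)"
    by (intro mult_left_mono) auto
  also have "\<dots> = energy p f"
    using r by (simp add: mult.assoc[symmetric] ennreal_mult[symmetric])
  finally show "ennreal (unit_ball_vol DIM('a) * r ^ DIM('a) / (4 * r) powr p) \<le> energy p f"
    using r by (simp add: ennreal_mult[symmetric])
qed

text \<open>The step function is composed with the squared norm, which is smooth also at the origin.
  The radius c halfway between s and S leaves room for a compact support in the open ball. Radial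
  monotonicity is what the dilation argument for ball capacities will need.\<close>

lemma radial_cutoff_exists:
  fixes s S :: real
  assumes "0 < s" "s < S"
  shows "\<exists>\<eta>\<in>test_functions (ball (0::'a::euclidean_space) S).
    (\<forall>x\<in>cball 0 s. \<eta> x = 1) \<and> (\<forall>x. 0 \<le> \<eta> x \<and> \<eta> x \<le> 1) \<and>
    (\<forall>x y. norm x \<le> norm y \<longrightarrow> \<eta> y \<le> \<eta> x)"
proof -
  define c where "c = (s + S) / 2"
  have c: "s < c" "c < S" "0 < c" using assms by (auto simp: c_def)
  \<comment> \<open>Chosen so that the argument of the step is 1 on the sphere of radius s and 0 on
    the sphere of radius c.\<close>
  define k where "k = 1 / (c\<^sup>2 - s\<^sup>2)"
  have sc: "s\<^sup>2 < c\<^sup>2" using assms c by (intro power_strict_mono) auto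
  then have k: "0 < k" by (simp add: k_def)
  define \<eta> where "\<eta> x = smooth_step (k * (c\<^sup>2 - x \<bullet> x))" for x :: 'a
  have sm: "smooth \<eta>"
    unfolding \<eta>_def
    by (rule smooth_compose[OF smooth_mult[OF smooth_const smooth_diff[OF smooth_const smooth_inner_self]]
          smooth_smooth_step])
  have "\<eta> \<in> test_functions (ball 0 S)"
  proof (rule test_functionsI[OF sm, of "cball 0 c"])
    fix x :: 'a assume "x \<notin> cball 0 c"
    then have "c\<^sup>2 \<le> (norm x)\<^sup>2" using c by (intro power_mono) auto
    then show "\<eta> x = 0"
      unfolding \<eta>_def using k
      by (intro smooth_step_0) (simp add: power2_norm_eq_inner mult_nonneg_nonpos)
  qed (use c in auto)
  moreover have "\<eta> x = 1" if "x \<in> cball 0 s" for x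
  proof -
    have "(norm x)\<^sup>2 \<le> s\<^sup>2" using that by (intro power_mono) auto
    then have "c\<^sup>2 - s\<^sup>2 \<le> c\<^sup>2 - x \<bullet> x" by (simp add: power2_norm_eq_inner)
    then have "1 \<le> k * (c\<^sup>2 - x \<bullet> x)"
      using sc by (simp add: k_def field_simps)
    then show ?thesis by (simp add: \<eta>_def smooth_step_1)
  qed
  moreover have "\<eta> y \<le> \<eta> x" if "norm x \<le> norm y" for x y
  proof -
    have "(norm x)\<^sup>2 \<le> (norm y)\<^sup>2" using that by (intro power_mono) auto
    then show ?thesis
      unfolding \<eta>_def using k
      by (intro smooth_step_mono mult_left_mono) (auto simp: power2_norm_eq_inner)
  qed
  ultimately show ?thesis
    by (intro bexI[of _ \<eta>]) (auto simp: \<eta>_def smooth_step_nonneg smooth_step_le_1)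
qed

section \<open>The lower bound\<close>

text \<open>The map sending the ball of radius r around y to the unit ball, in the shape
  \<open>b + a *\<^sub>R x\<close> used by the affine lemmas.\<close>

lemma norm_rescale:
  assumes "0 < r"
  shows "norm (- (1 / r) *\<^sub>R y + (1 / r) *\<^sub>R x) = dist y x / r"
proof -
  have "- (1 / r) *\<^sub>R y + (1 / r) *\<^sub>R x = (1 / r) *\<^sub>R (x - y)" by (simp add: algebra_simps)
  then show ?thesis using assms by (simp add: dist_norm norm_minus_commute)
qed

text \<open>Off \<Omega> the function u vanishes, so the competitor v equals the cut-off there,
  which is 1 on the closed ball. Multiplying v by u y removes the denominator: the gradient becomes
  -\<eta> grad u + (u y - u) grad \<eta>, with no trace of how small u y is. If u y = 0 the left
  side is 0.\<close>

lemma capacity_Maz'ya_pointwise: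
  fixes u \<eta> :: "'a::euclidean_space \<Rightarrow> real"
  assumes p: "1 \<le> p" and r: "0 < r" and u: "u \<in> test_functions \<Omega>"
    and \<eta>: "\<eta> \<in> test_functions (ball 0 2)" "\<And>x. x \<in> cball 0 1 \<Longrightarrow> \<eta> x = 1"
      "\<And>x. 0 \<le> \<eta> x \<and> \<eta> x \<le> 1"
    and M: "0 < M" "\<And>x. norm (gradient \<eta> x) \<le> M"
  shows "ennreal (\<bar>u y\<bar> powr p) * capacity p (cball y r - \<Omega>) (ball y (2 * r))
    \<le> (\<integral>\<^sup>+x\<in>ball y (2 * r). ennreal (2 powr (p - 1) *
        (norm (gradient u x) powr p + (M / r) powr p * \<bar>u x - u y\<bar> powr p)) \<partial>lborel)"
proof (cases "u y = 0")
  case False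
  define m where "m = u y"
  have m: "m \<noteq> 0" using False by (simp add: m_def)
  note su = test_functions_smooth[OF u]
  define \<eta>r where "\<eta>r x = \<eta> (- (1 / r) *\<^sub>R y + (1 / r) *\<^sub>R x)" for x
  define v where "v x = \<eta>r x * (1 - (1 / m) * u x)" for x
  note arg = norm_rescale[OF r, of y]
  have \<eta>r: "\<eta>r \<in> test_functions (ball y (2 * r))"
    unfolding \<eta>r_def
  proof (rule test_functions_mono[OF test_functions_affine[OF \<eta>(1)]])
    show "{x. - (1 / r) *\<^sub>R y + (1 / r) *\<^sub>R x \<in> ball 0 2} \<subseteq> ball y (2 * r)"
      unfolding mem_ball_0 arg using r by (auto simp: field_simps)
  qed (use r in simp)
  have s2: "smooth (\<lambda>x. 1 - (1 / m) * u x)"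
    by (intro smooth_diff smooth_mult smooth_const su)
  have v: "v \<in> test_functions (ball y (2 * r))"
    unfolding v_def by (rule test_functions_mult[OF \<eta>r s2])
  have "1 \<le> v x" if "x \<in> cball y r - \<Omega>" for x
  proof -
    have "\<eta>r x = 1"
      unfolding \<eta>r_def by (rule \<eta>(2)) (use that r in \<open>simp add: arg del: scaleR_minus_left\<close>)
    then show ?thesis
      using test_functions_0[OF u, of x] that by (simp add: v_def)
  qed
  then have "capacity p (cball y r - \<Omega>) (ball y (2 * r)) \<le> energy p v"
    by (rule capacity_le_energy[OF v])
  then have "ennreal (\<bar>m\<bar> powr p) * capacity p (cball y r - \<Omega>) (ball y (2 * r))
      \<le> ennreal (\<bar>m\<bar> powr p) * energy p v"
    by (rule mult_left_mono) simp
  also have "\<dots> = energy p (\<lambda>x. m * v x)"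
    by (rule energy_cmult[symmetric, OF test_functions_smooth[OF v]])
  also have "\<dots> \<le> (\<integral>\<^sup>+x\<in>ball y (2 * r). ennreal (2 powr (p - 1) *
        (norm (gradient u x) powr p + (M / r) powr p * \<bar>u x - u y\<bar> powr p)) \<partial>lborel)"
    unfolding energy_def
  proof (rule nn_integral_mono)
    fix x
    have gv: "gradient (\<lambda>x. m * v x) x = m *\<^sub>R gradient v x"
      by (rule gradient_cmult[OF test_functions_smooth[OF v]])
    show "ennreal (norm (gradient (\<lambda>x. m * v x) x) powr p)
        \<le> ennreal (2 powr (p - 1) * (norm (gradient u x) powr p + (M / r) powr p * \<bar>u x - u y\<bar> powr p))
          * indicator (ball y (2 * r)) x"
    proof (cases "x \<in> ball y (2 * r)")
      case False
      then have "gradient v x = 0"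
        using test_functions_support[OF v] by auto
      then show ?thesis by (simp add: gv)
    next
      case True
      have "gradient v x = \<eta>r x *\<^sub>R (- ((1 / m) *\<^sub>R gradient u x)) + (1 - (1 / m) * u x) *\<^sub>R gradient \<eta>r x"
        unfolding v_def gradient_mult[OF test_functions_smooth[OF \<eta>r] s2]
          gradient_const_diff[OF smooth_mult[OF smooth_const su]] gradient_cmult[OF su] ..
      then have eq: "m *\<^sub>R gradient v x = - (\<eta>r x *\<^sub>R gradient u x) + (m - u x) *\<^sub>R gradient \<eta>r x"
        using m by (simp add: scaleR_right_distrib scaleR_right_diff_distrib right_diff_distrib)
      have "norm (gradient \<eta>r x) \<le> M / r"
      proof -
        have "gradient \<eta>r x = (1 / r) *\<^sub>R gradient \<eta> (- (1 / r) *\<^sub>R y + (1 / r) *\<^sub>R x)"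
          unfolding \<eta>r_def by (rule gradient_affine[OF test_functions_smooth[OF \<eta>(1)]])
        then have "norm (gradient \<eta>r x) = (1 / r) * norm (gradient \<eta> (- (1 / r) *\<^sub>R y + (1 / r) *\<^sub>R x))"
          using r by (simp only: norm_scaleR) simp
        also have "\<dots> \<le> (1 / r) * M"
          by (rule mult_left_mono[OF M(2)]) (use r in simp)
        finally show ?thesis by simp
      qed
      then have 1: "\<bar>m - u x\<bar> * norm (gradient \<eta>r x) \<le> \<bar>m - u x\<bar> * (M / r)"
        by (rule mult_left_mono) simp
      have "\<bar>\<eta>r x\<bar> \<le> 1" using \<eta>(3) by (simp add: \<eta>r_def)
      then have 2: "\<bar>\<eta>r x\<bar> * norm (gradient u x) \<le> 1 * norm (gradient u x)"
        by (rule mult_right_mono) simp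
      have "norm (m *\<^sub>R gradient v x) \<le> \<bar>\<eta>r x\<bar> * norm (gradient u x) + \<bar>m - u x\<bar> * norm (gradient \<eta>r x)"
        unfolding eq by (rule norm_triangle_le) simp
      with 1 2 have "norm (m *\<^sub>R gradient v x) \<le> 1 * norm (gradient u x) + \<bar>m - u x\<bar> * (M / r)"
        by linarith
      then have "norm (m *\<^sub>R gradient v x) \<le> norm (gradient u x) + (M / r) * \<bar>u x - u y\<bar>"
        by (simp add: m_def abs_minus_commute mult.commute)
      then have "norm (m *\<^sub>R gradient v x) powr p \<le> (norm (gradient u x) + (M / r) * \<bar>u x - u y\<bar>) powr p"
        using p by (intro powr_mono2) auto
      also have "\<dots> \<le> 2 powr (p - 1) * (norm (gradient u x) powr p + ((M / r) * \<bar>u x - u y\<bar>) powr p)"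
        using M(1) r p by (intro powr_add_le_2) auto
      finally have "norm (m *\<^sub>R gradient v x) powr p
          \<le> 2 powr (p - 1) * (norm (gradient u x) powr p + (M / r) powr p * \<bar>u x - u y\<bar> powr p)"
        using M(1) r by (simp only: powr_mult)
      then show ?thesis
        using True by (simp add: gv ennreal_leI)
    qed
  qed
  finally show ?thesis by (simp add: m_def)
qed simp

text \<open>Integrate the pointwise bound over all centres y and write x = y + h. After Fubini the
  shift h ranges over a ball of radius 2r, and for fixed h the y-integral of the differences is at
  most \<open>(2 * r) powr p\<close> times the energy. This cancels the \<open>1 / r powr p\<close>
  coming from the cut-off.\<close>

lemma poincare_const_ge:
  fixes p :: real
  assumes p: "1 \<le> p"
  shows "\<exists>\<sigma>>0. \<forall>\<gamma> r. \<forall>\<Omega>::'a::euclidean_space set. 0 < \<gamma> \<longrightarrow> 0 < r \<longrightarrow> open \<Omega> \<longrightarrow>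
    (\<forall>x0. \<not> capacity_negligible p \<gamma> x0 r (cball x0 r - \<Omega>)) \<longrightarrow>
    ennreal (\<sigma> * \<gamma> / r powr p) \<le> poincare_const p \<Omega>"
proof -
  let ?N = "DIM('a)"
  obtain \<eta> :: "'a \<Rightarrow> real" where \<eta>: "\<eta> \<in> test_functions (ball 0 2)" "\<And>x. x \<in> cball 0 1 \<Longrightarrow> \<eta> x = 1"
      "\<And>x. 0 \<le> \<eta> x \<and> \<eta> x \<le> 1"
    using radial_cutoff_exists[of 1 2, where ?'a = 'a] by auto
  obtain M where M: "0 < M" "\<And>x. norm (gradient \<eta> x) \<le> M"
    by (rule gradient_bounded[OF \<eta>(1)]) (rule that)
  \<comment> \<open>\<open>2 powr (p - 1)\<close> comes from splitting the gradient, 2M is the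
    cut-off slope M/r times the largest shift 2r, and \<open>2 ^ ?N\<close> compares the volumes of
    the balls of radius 2r and r.\<close>
  define A where "A = 2 powr (p - 1) * (1 + (2 * M) powr p) * 2 ^ ?N"
  have A: "0 < A" by (simp add: A_def add_pos_nonneg)
  \<comment> \<open>The factor \<open>4 powr p\<close> is the one in
    \<open>capacity_ball_ge\<close>.\<close>
  define \<sigma> where "\<sigma> = 1 / (4 powr p * A)"
  have "ennreal (\<sigma> * \<gamma> / r powr p) \<le> poincare_const p \<Omega>"
    if \<gamma>: "0 < \<gamma>" and r: "0 < r" and \<Omega>: "open \<Omega>"
      and neg: "\<And>x0. \<not> capacity_negligible p \<gamma> x0 r (cball x0 r - \<Omega>)" for \<gamma> r and \<Omega> :: "'a set"
  proof (rule poincare_const_greatest[OF p])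
    fix u assume u: "u \<in> test_functions \<Omega>"
    note su = test_functions_smooth[OF u]
    note [measurable] = measurable_norm_gradient[OF su] measurable_smooth[OF su]
    define w where "w = unit_ball_vol ?N"
    have w: "0 < w" by (simp add: w_def)
    define k where "k = \<gamma> * (w * r ^ ?N / (4 * r) powr p)"
    have cap: "ennreal k \<le> capacity p (cball y r - \<Omega>) (ball y (2 * r))" for y
    proof -
      have "compact (cball y r - \<Omega>)"
        using compact_Int_closed[OF compact_cball closed_Compl[OF \<Omega>]] by (simp add: Diff_eq)
      then have "ennreal \<gamma> * capacity p (cball y r) (ball y (2 * r))
          < capacity p (cball y r - \<Omega>) (ball y (2 * r))"
        using neg[of y] by (auto simp: capacity_negligible_def not_le)
      moreover have "ennreal k \<le> ennreal \<gamma> * capacity p (cball y r) (ball y (2 * r))"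
        unfolding k_def w_def using \<gamma> capacity_ball_ge[OF p r, of y]
        by (subst ennreal_mult) (auto intro: mult_left_mono simp: r less_imp_le)
      ultimately show ?thesis by simp
    qed
    define G where "G x = ennreal (norm (gradient u x) powr p)" for x
    define a where "a = 2 powr (p - 1)"
    define B where "B = ball (0::'a) (2 * r)"
    have [measurable]: "B \<in> sets borel" by (simp add: B_def)
    \<comment> \<open>Written on pairs so that joint continuity provides the product measurability
      needed for Fubini.\<close>
    define K where "K z = \<bar>u (fst z + snd z) - u (fst z)\<bar> powr p" for z :: "'a \<times> 'a"
    have "continuous_on UNIV K"
      unfolding K_def
      by (intro continuous_on_powr_nonneg continuous_on_rabs continuous_on_diff p
          continuous_on_compose2[OF smooth_continuous_on[OF su]] continuous_intros) simp_all
    then have [measurable]: "K \<in> borel_measurable (borel \<Otimes>\<^sub>M borel)"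
      unfolding borel_prod by (rule borel_measurable_continuous_onI)
    let ?H = "\<lambda>h y. (ennreal a * G (y + h) + ennreal (a * (M / r) powr p) * ennreal (K (y, h)))"
    have [measurable]: "G \<in> borel_measurable borel" unfolding G_def by measurable
    have E: "energy p u = (\<integral>\<^sup>+y. G (y + h) \<partial>lborel)" for h
      using nn_integral_lborel_affine[of G 1 h] by (simp add: energy_def G_def add.commute)
    have "ennreal k * mass p u = (\<integral>\<^sup>+y. ennreal k * ennreal (\<bar>u y\<bar> powr p) \<partial>lborel)"
      unfolding mass_def by (rule nn_integral_cmult[symmetric]) measurable
    also have "\<dots> \<le> (\<integral>\<^sup>+y. (\<integral>\<^sup>+h. ?H h y * indicator B h \<partial>lborel) \<partial>lborel)"
    proof (rule nn_integral_mono)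
      fix y
      let ?F = "\<lambda>x. ennreal (2 powr (p - 1) *
        (norm (gradient u x) powr p + (M / r) powr p * \<bar>u x - u y\<bar> powr p)) * indicator (ball y (2 * r)) x"
      have F: "?F (y + h) = ?H h y * indicator B h" for h
        by (simp add: a_def G_def K_def B_def indicator_def dist_norm distrib_left ennreal_mult'[symmetric] mult.assoc
            flip: ennreal_plus)
      have "ennreal k * ennreal (\<bar>u y\<bar> powr p)
          \<le> ennreal (\<bar>u y\<bar> powr p) * capacity p (cball y r - \<Omega>) (ball y (2 * r))"
        using mult_left_mono[OF cap, of "ennreal (\<bar>u y\<bar> powr p)" y] by (simp add: mult.commute)
      also have "\<dots> \<le> (\<integral>\<^sup>+x. ?F x \<partial>lborel)"
        by (rule capacity_Maz'ya_pointwise[OF p r u \<eta> M])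
      also have "\<dots> = (\<integral>\<^sup>+h. ?F (y + h) \<partial>lborel)"
      proof -
        have "(\<lambda>x. 2 powr (p - 1) * (norm (gradient u x) powr p + (M / r) powr p * \<bar>u x - u y\<bar> powr p))
            \<in> borel_measurable borel"
          by (intro borel_measurable_continuous_onI continuous_on_mult_left continuous_on_add
              continuous_on_powr_nonneg continuous_on_norm continuous_on_rabs continuous_on_diff
              continuous_on_const continuous_on_gradient smooth_continuous_on su p) simp_all
        then have "?F \<in> borel_measurable borel"
          by (intro borel_measurable_times_ennreal measurable_compose[OF _ measurable_ennreal]
              borel_measurable_indicator) simp_all
        from nn_integral_lborel_affine[OF this, of 1 y]
        show ?thesis by (simp only: scaleR_one abs_one power_one ennreal_1 mult_1 one_neq_zero not_False_eq_True)
      qed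
      finally show "ennreal k * ennreal (\<bar>u y\<bar> powr p)
          \<le> (\<integral>\<^sup>+h. ?H h y * indicator B h \<partial>lborel)"
        by (simp only: F)
    qed
    also have "\<dots> = (\<integral>\<^sup>+h. (\<integral>\<^sup>+y. ?H h y * indicator B h \<partial>lborel) \<partial>lborel)"
      by (rule lborel_pair.Fubini') measurable
    also have "\<dots> \<le> (\<integral>\<^sup>+h. (ennreal (a * (1 + (2 * M) powr p)) * energy p u) * indicator B h \<partial>lborel)"
    proof (rule nn_integral_mono)
      fix h :: 'a
      show "(\<integral>\<^sup>+y. ?H h y * indicator B h \<partial>lborel)
          \<le> (ennreal (a * (1 + (2 * M) powr p)) * energy p u) * indicator B h"
      proof (cases "h \<in> B")
        case True
        have "(\<integral>\<^sup>+y. ?H h y \<partial>lborel) = ennreal a * energy p u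
            + ennreal (a * (M / r) powr p) * (\<integral>\<^sup>+y. ennreal (K (y, h)) \<partial>lborel)"
          by (subst nn_integral_add) (simp_all add: nn_integral_cmult E[of h])
        also have "\<dots> \<le> ennreal a * energy p u
            + ennreal (a * (M / r) powr p) * (ennreal ((2 * r) powr p) * energy p u)"
        proof (intro add_left_mono mult_left_mono)
          have "ennreal (norm h powr p) * energy p u \<le> ennreal ((2 * r) powr p) * energy p u"
            using True p by (intro mult_right_mono ennreal_leI powr_mono2) (auto simp: B_def)
          with translation_difference_le_energy[OF su p, of h]
          show "(\<integral>\<^sup>+y. ennreal (K (y, h)) \<partial>lborel) \<le> ennreal ((2 * r) powr p) * energy p u"
            unfolding K_def fst_conv snd_conv by (rule order_trans)
        qed simp
        also have "\<dots> = (ennreal a + ennreal (a * (M / r) powr p * (2 * r) powr p)) * energy p u"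
          by (simp add: distrib_right ennreal_mult' mult.assoc a_def)
        also have "a * (M / r) powr p * (2 * r) powr p = a * (2 * M) powr p"
          using M(1) r by (simp add: powr_divide powr_mult)
        also have "ennreal a + ennreal (a * (2 * M) powr p) = ennreal (a * (1 + (2 * M) powr p))"
          by (simp add: a_def distrib_left flip: ennreal_plus)
        finally show ?thesis using True by simp
      qed simp
    qed
    also have "\<dots> = ennreal (a * (1 + (2 * M) powr p)) * energy p u * ennreal (w * (2 * r) ^ ?N)"
      using r by (simp add: nn_integral_cmult_indicator emeasure_ball B_def w_def)
    also have "\<dots> = ennreal (A * w * r ^ ?N) * energy p u"
    proof -
      have "ennreal (A * w * r ^ ?N) = ennreal ((a * (1 + (2 * M) powr p)) * (w * (2 * r) ^ ?N))"
        by (simp add: A_def a_def power_mult_distrib ac_simps)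
      also have "\<dots> = ennreal (a * (1 + (2 * M) powr p)) * ennreal (w * (2 * r) ^ ?N)"
        using r w by (intro ennreal_mult) (auto simp: a_def)
      finally show ?thesis by (simp add: ac_simps)
    qed
    finally have "ennreal k * mass p u \<le> ennreal (A * w * r ^ ?N) * energy p u" .
    then have "ennreal (1 / (A * w * r ^ ?N)) * (ennreal k * mass p u)
        \<le> ennreal (1 / (A * w * r ^ ?N)) * (ennreal (A * w * r ^ ?N) * energy p u)"
      by (rule mult_left_mono) simp
    moreover have "ennreal (1 / (A * w * r ^ ?N)) * ennreal k = ennreal (\<sigma> * \<gamma> / r powr p)"
    proof -
      have "1 / (A * w * r ^ ?N) * k = \<sigma> * \<gamma> / r powr p"
        using A r w by (simp add: k_def \<sigma>_def powr_mult field_simps)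
      then show ?thesis
        using A r w \<gamma> by (subst ennreal_mult[symmetric]) (auto simp: k_def)
    qed
    moreover have "ennreal (1 / (A * w * r ^ ?N)) * ennreal (A * w * r ^ ?N) = 1"
      using A r w by (subst ennreal_mult[symmetric]) auto
    ultimately show "ennreal (\<sigma> * \<gamma> / r powr p) * mass p u \<le> energy p u"
      by (simp add: mult.assoc[symmetric])
  qed
  moreover have "0 < \<sigma>" using A by (simp add: \<sigma>_def)
  ultimately show ?thesis by blast
qed

section \<open>The upper bound\<close>

text \<open>A competitor for the smaller ball is turned into one for the larger ball by interpolating,
  with a radially decreasing weight \<open>\<theta>\<close>, between it and its dilation; the interpolation error is a
  difference quotient.\<close>

lemma dilation_interpolation:
  fixes f \<theta> :: "'a::euclidean_space \<Rightarrow> real"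
  assumes p: "1 \<le> p" and s: "0 < s" "s < 1"
    and \<theta>: "\<theta> \<in> test_functions (ball 0 2)" "\<And>x. x \<in> cball 0 1 \<Longrightarrow> \<theta> x = 1"
      "\<And>x. 0 \<le> \<theta> x \<and> \<theta> x \<le> 1" "\<And>x y. norm x \<le> norm y \<Longrightarrow> \<theta> y \<le> \<theta> x"
    and M: "0 < M" "\<And>x. norm (gradient \<theta> x) \<le> M"
    and f: "f \<in> test_functions (ball 0 2)" "\<And>x. x \<in> cball 0 s \<Longrightarrow> 1 \<le> f x"
  shows "capacity p (cball (0::'a) 1) (ball 0 2)
    \<le> ennreal (1 / s ^ DIM('a) * (s powr (1 - p) + (1 - s) * (2 * M) powr p)) * energy p f"
proof -
  note sf = test_functions_smooth[OF f(1)] and s\<theta> = test_functions_smooth[OF \<theta>(1)]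
  \<comment> \<open>The idle summand 0 keeps the shape \<open>b + a *\<^sub>R x\<close> of the
    affine lemmas.\<close>
  define fs where "fs x = f (0 + s *\<^sub>R x)" for x
  have sfs: "smooth fs" unfolding fs_def by (rule smooth_affine[OF sf])
  have s1: "smooth (\<lambda>x. 1 - \<theta> x)" by (rule smooth_diff[OF smooth_const s\<theta>])
  \<comment> \<open>The dilation \<open>fs\<close> alone is not admissible: its support may reach
    outside the fixed outer ball of radius 2. It is used only where \<theta> lives, and f takes over
    elsewhere.\<close>
  define u where "u x = \<theta> x * fs x + f x * (1 - \<theta> x)" for x
  have u: "u \<in> test_functions (ball 0 2)"
    unfolding u_def
    by (rule test_functions_add[OF test_functions_mult[OF \<theta>(1) sfs] test_functions_mult[OF f(1) s1]])
  have "1 \<le> u x" if "x \<in> cball 0 1" for x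
  proof -
    have "0 + s *\<^sub>R x \<in> cball 0 s" using that s by (simp add: mult_left_le)
    from f(2)[OF this] show ?thesis using \<theta>(2)[OF that] by (simp add: u_def fs_def)
  qed
  then have "capacity p (cball (0::'a) 1) (ball 0 2) \<le> energy p u"
    by (rule capacity_le_energy[OF u])
  also have "\<dots> \<le> (\<integral>\<^sup>+x. ennreal (s powr (1 - p)) *
      (ennreal (\<theta> x) * ennreal (norm (gradient f (0 + s *\<^sub>R x)) powr p) + ennreal (1 - \<theta> x) * ennreal (norm (gradient f x) powr p))
      + ennreal ((1 - s) powr (1 - p) * M powr p) * (ennreal (\<bar>fs x - f x\<bar> powr p) * indicator (ball 0 2) x) \<partial>lborel)"
    unfolding energy_def
  proof (rule nn_integral_mono)
    fix x
    let ?g = "norm (gradient f (0 + s *\<^sub>R x))" and ?h = "norm (gradient f x)"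
    define I :: real where "I = indicator (ball 0 2) x"
    have I: "0 \<le> I" "I \<le> 1" by (auto simp: I_def indicator_def)
    have "gradient u x = (\<theta> x *\<^sub>R gradient fs x + fs x *\<^sub>R gradient \<theta> x)
        + (f x *\<^sub>R (- gradient \<theta> x) + (1 - \<theta> x) *\<^sub>R gradient f x)"
      unfolding u_def gradient_add[OF smooth_mult[OF s\<theta> sfs] smooth_mult[OF sf s1]]
        gradient_mult[OF s\<theta> sfs] gradient_mult[OF sf s1] gradient_const_diff[OF s\<theta>] ..
    then have eq: "gradient u x = (\<theta> x *\<^sub>R gradient fs x + (1 - \<theta> x) *\<^sub>R gradient f x)
        + (fs x - f x) *\<^sub>R gradient \<theta> x"
      by (simp add: algebra_simps)
    have gfs: "norm (gradient fs x) \<le> ?g"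
    proof -
      have "norm (gradient fs x) = s * ?g"
        unfolding fs_def gradient_affine[OF sf] using s by simp
      also have "\<dots> \<le> 1 * ?g" by (rule mult_right_mono) (use s in auto)
      finally show ?thesis by simp
    qed
    have g\<theta>: "norm (gradient \<theta> x) \<le> M * I"
    proof (cases "x \<in> ball 0 2")
      case False
      then have "gradient \<theta> x = 0" using test_functions_support[OF \<theta>(1)] by auto
      then show ?thesis using M I by simp
    qed (use M in \<open>simp add: I_def\<close>)
    have "norm (gradient u x) \<le> (\<theta> x * norm (gradient fs x) + (1 - \<theta> x) * ?h) + \<bar>fs x - f x\<bar> * norm (gradient \<theta> x)"
      unfolding eq using \<theta>(3)[of x]
      by (intro norm_triangle_le add_mono) (simp_all add: norm_triangle_le)
    moreover have "\<theta> x * norm (gradient fs x) \<le> \<theta> x * ?g"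
      by (rule mult_left_mono[OF gfs]) (use \<theta>(3) in simp)
    moreover have "\<bar>fs x - f x\<bar> * norm (gradient \<theta> x) \<le> \<bar>fs x - f x\<bar> * (M * I)"
      by (rule mult_left_mono[OF g\<theta>]) simp
    \<comment> \<open>The weight \<theta> is written as 1 - (1 - \<theta>) to fit the form of
      \<open>powr_convex_combination\<close>.\<close>
    ultimately have "norm (gradient u x) \<le> ((1 - (1 - \<theta> x)) * ?g + (1 - \<theta> x) * ?h) + \<bar>fs x - f x\<bar> * (M * I)"
      by simp
    then have "norm (gradient u x) powr p \<le> (((1 - (1 - \<theta> x)) * ?g + (1 - \<theta> x) * ?h) + \<bar>fs x - f x\<bar> * (M * I)) powr p"
      using p by (intro powr_mono2) auto
    \<comment> \<open>Splitting with weight 1 - s: the main part costs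
      \<open>s powr (1 - p)\<close>, which tends to 1. The error pays
      \<open>(1 - s) powr (1 - p)\<close>, but the difference f(sx) - f(x) contributes
      \<open>(1 - s) powr p\<close> after integration, so altogether it is of order 1 - s.\<close>
    also have "\<dots> \<le> (1 - (1 - s)) powr (1 - p) * ((1 - (1 - \<theta> x)) * ?g + (1 - \<theta> x) * ?h) powr p
        + (1 - s) powr (1 - p) * (\<bar>fs x - f x\<bar> * (M * I)) powr p"
      using \<theta>(3)[of x] M I p s by (intro powr_add_le add_nonneg_nonneg mult_nonneg_nonneg) auto
    also have "\<dots> \<le> (1 - (1 - s)) powr (1 - p) * ((1 - (1 - \<theta> x)) * ?g powr p + (1 - \<theta> x) * ?h powr p)
        + (1 - s) powr (1 - p) * (\<bar>fs x - f x\<bar> * (M * I)) powr p"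
      using \<theta>(3)[of x] p by (intro add_right_mono mult_left_mono powr_convex_combination) auto
    also have "(\<bar>fs x - f x\<bar> * (M * I)) powr p = M powr p * (\<bar>fs x - f x\<bar> powr p * I)"
    proof -
      have "I powr p = I" by (simp add: I_def indicator_def)
      then show ?thesis using M I by (simp add: powr_mult)
    qed
    finally have le: "norm (gradient u x) powr p \<le> s powr (1 - p) * (\<theta> x * ?g powr p + (1 - \<theta> x) * ?h powr p)
        + ((1 - s) powr (1 - p) * M powr p) * (\<bar>fs x - f x\<bar> powr p * I)"
      by (simp add: mult.assoc)
    have iI: "indicator (ball 0 2) x = ennreal I" by (simp add: I_def indicator_def)
    have "ennreal (norm (gradient u x) powr p) \<le> ennreal (s powr (1 - p) * (\<theta> x * ?g powr p + (1 - \<theta> x) * ?h powr p)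
        + ((1 - s) powr (1 - p) * M powr p) * (\<bar>fs x - f x\<bar> powr p * I))"
      by (rule ennreal_leI[OF le])
    also have "\<dots> = ennreal (s powr (1 - p)) *
      (ennreal (\<theta> x) * ennreal (?g powr p) + ennreal (1 - \<theta> x) * ennreal (?h powr p))
      + ennreal ((1 - s) powr (1 - p) * M powr p) * (ennreal (\<bar>fs x - f x\<bar> powr p) * indicator (ball 0 2) x)"
      unfolding iI using \<theta>(3)[of x] I
      by (simp add: ennreal_plus[symmetric] ennreal_mult[symmetric] del: ennreal_plus)
    finally show "ennreal (norm (gradient u x) powr p) \<le> \<dots>" .
  qed
  also have "\<dots> = ennreal (s powr (1 - p)) *
      ((\<integral>\<^sup>+x. ennreal (\<theta> x) * ennreal (norm (gradient f (0 + s *\<^sub>R x)) powr p) \<partial>lborel)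
        + (\<integral>\<^sup>+x. ennreal (1 - \<theta> x) * ennreal (norm (gradient f x) powr p) \<partial>lborel))
      + ennreal ((1 - s) powr (1 - p) * M powr p) * (\<integral>\<^sup>+x\<in>ball 0 2. ennreal (\<bar>fs x - f x\<bar> powr p) \<partial>lborel)"
  proof -
    define B where "B = ball (0::'a) 2"
    define F1 where "F1 x = ennreal (\<theta> x) * ennreal (norm (gradient f (0 + s *\<^sub>R x)) powr p)" for x
    define F2 where "F2 x = ennreal (1 - \<theta> x) * ennreal (norm (gradient f x) powr p)" for x
    define F3 where "F3 x = ennreal (\<bar>fs x - f x\<bar> powr p) * indicator B x" for x
    note [measurable] = measurable_norm_gradient[OF sf] measurable_smooth[OF s\<theta>]
        measurable_smooth[OF sf] measurable_smooth[OF sfs]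
    have [measurable]: "B \<in> sets borel" by (simp add: B_def)
    have [measurable]: "F1 \<in> borel_measurable borel" unfolding F1_def by measurable
    have [measurable]: "F2 \<in> borel_measurable borel" unfolding F2_def by measurable
    have [measurable]: "F3 \<in> borel_measurable borel" unfolding F3_def by measurable
    have "(\<integral>\<^sup>+x. ennreal (s powr (1 - p)) * (F1 x + F2 x) + ennreal ((1 - s) powr (1 - p) * M powr p) * F3 x \<partial>lborel)
      = ennreal (s powr (1 - p)) * ((\<integral>\<^sup>+x. F1 x \<partial>lborel) + (\<integral>\<^sup>+x. F2 x \<partial>lborel))
        + ennreal ((1 - s) powr (1 - p) * M powr p) * (\<integral>\<^sup>+x. F3 x \<partial>lborel)"
      by (simp add: nn_integral_add nn_integral_cmult)
    then show ?thesis by (simp only: F1_def F2_def F3_def B_def)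
  qed
  also have "\<dots> \<le> ennreal (s powr (1 - p)) * (ennreal (1 / s ^ DIM('a)) * energy p f)
      + ennreal ((1 - s) powr (1 - p) * M powr p) * (ennreal ((2 * (1 - s)) powr p / s ^ DIM('a)) * energy p f)"
  proof (intro add_mono mult_left_mono)
    note [measurable] = measurable_norm_gradient[OF sf] measurable_smooth[OF s\<theta>]
    let ?G = "\<lambda>x. ennreal (norm (gradient f x) powr p)"
    have s1N: "1 \<le> 1 / s ^ DIM('a)" using s by (simp add: power_le_one)
    have "(\<integral>\<^sup>+x. ennreal (\<theta> x) * ?G (0 + s *\<^sub>R x) \<partial>lborel) \<le> ennreal (1 / s ^ DIM('a)) * (\<integral>\<^sup>+x. ennreal (\<theta> x) * ?G x \<partial>lborel)"
    proof -
      have "(\<integral>\<^sup>+x. ennreal (\<theta> x) * ?G (0 + s *\<^sub>R x) \<partial>lborel) \<le> (\<integral>\<^sup>+x. ennreal (\<theta> (0 + s *\<^sub>R x)) * ?G (0 + s *\<^sub>R x) \<partial>lborel)"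
        \<comment> \<open>Since \<theta> decreases radially, its value at x is at most its value at
          the contracted point. After the change of variables both gradients sit at the same point
          and the weights \<theta> and 1 - \<theta> add up to 1, so only one copy of the energy
          appears.\<close>
        using s by (intro nn_integral_mono mult_right_mono ennreal_leI \<theta>(4)) (auto simp: mult_left_le_one_le)
      also have "\<dots> = ennreal (1 / s ^ DIM('a)) * (ennreal (s ^ DIM('a)) * \<dots>)"
        using s by (simp add: mult.assoc[symmetric] ennreal_mult[symmetric])
      also have "ennreal (s ^ DIM('a)) * (\<integral>\<^sup>+x. ennreal (\<theta> (0 + s *\<^sub>R x)) * ?G (0 + s *\<^sub>R x) \<partial>lborel)
          = (\<integral>\<^sup>+x. ennreal (\<theta> x) * ?G x \<partial>lborel)"
        using nn_integral_lborel_affine[of "\<lambda>x. ennreal (\<theta> x) * ?G x" s 0] s by simp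
      finally show ?thesis .
    qed
    moreover have "(\<integral>\<^sup>+x. ennreal (1 - \<theta> x) * ?G x \<partial>lborel) \<le> ennreal (1 / s ^ DIM('a)) * (\<integral>\<^sup>+x. ennreal (1 - \<theta> x) * ?G x \<partial>lborel)"
      using mult_right_mono[OF ennreal_leI[OF s1N], of "\<integral>\<^sup>+x. ennreal (1 - \<theta> x) * ?G x \<partial>lborel"] by simp
    ultimately have "(\<integral>\<^sup>+x. ennreal (\<theta> x) * ?G (0 + s *\<^sub>R x) \<partial>lborel) + (\<integral>\<^sup>+x. ennreal (1 - \<theta> x) * ?G x \<partial>lborel)
        \<le> ennreal (1 / s ^ DIM('a)) * ((\<integral>\<^sup>+x. ennreal (\<theta> x) * ?G x \<partial>lborel) + (\<integral>\<^sup>+x. ennreal (1 - \<theta> x) * ?G x \<partial>lborel))"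
      by (simp add: distrib_left add_mono)
    also have "(\<integral>\<^sup>+x. ennreal (\<theta> x) * ?G x \<partial>lborel) + (\<integral>\<^sup>+x. ennreal (1 - \<theta> x) * ?G x \<partial>lborel)
        = (\<integral>\<^sup>+x. ennreal (\<theta> x) * ?G x + ennreal (1 - \<theta> x) * ?G x \<partial>lborel)"
      by (rule nn_integral_add[symmetric]) measurable
    also have "\<dots> = energy p f"
      unfolding energy_def
    proof (rule nn_integral_cong)
      fix x
      have "ennreal (\<theta> x) + ennreal (1 - \<theta> x) = 1"
        using \<theta>(3)[of x] by (simp add: ennreal_plus[symmetric] del: ennreal_plus)
      then show "ennreal (\<theta> x) * ?G x + ennreal (1 - \<theta> x) * ?G x = ?G x"
        by (metis distrib_right mult_1)
    qed
    finally show "(\<integral>\<^sup>+x. ennreal (\<theta> x) * ?G (0 + s *\<^sub>R x) \<partial>lborel) + (\<integral>\<^sup>+x. ennreal (1 - \<theta> x) * ?G x \<partial>lborel)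
        \<le> ennreal (1 / s ^ DIM('a)) * energy p f" .
    show "(\<integral>\<^sup>+x\<in>ball 0 2. ennreal (\<bar>fs x - f x\<bar> powr p) \<partial>lborel) \<le> ennreal ((2 * (1 - s)) powr p / s ^ DIM('a)) * energy p f"
      unfolding fs_def
    proof (rule affine_difference_le_energy[OF sf p])
      fix x :: 'a assume "x \<in> ball 0 2"
      have "norm (0 + s *\<^sub>R x - x) = norm ((s - 1) *\<^sub>R x)" by (simp add: algebra_simps)
      also have "\<dots> = (1 - s) * norm x" using s by simp
      also have "\<dots> \<le> (1 - s) * 2" using \<open>x \<in> ball 0 2\<close> s by (intro mult_left_mono) auto
      finally show "norm (0 + s *\<^sub>R x - x) \<le> 2 * (1 - s)" by simp
    qed (use s in auto)
  qed simp_all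
  also have "\<dots> = ennreal (1 / s ^ DIM('a) * (s powr (1 - p) + (1 - s) * (2 * M) powr p)) * energy p f"
  proof -
    have "(1 - s) powr (1 - p) * M powr p * ((2 * (1 - s)) powr p / s ^ DIM('a))
        = 1 / s ^ DIM('a) * ((1 - s) * (2 * M) powr p)"
    proof -
      have "(1 - s) = (1 - s) powr (1 - p) * (1 - s) powr p"
        using s by (simp add: powr_add[symmetric])
      moreover have "(2 * (1 - s)) powr p = 2 powr p * (1 - s) powr p"
        by (rule powr_mult)
      moreover have "(2 * M) powr p = 2 powr p * M powr p"
        by (rule powr_mult)
      ultimately have "1 / s ^ DIM('a) * ((1 - s) * (2 * M) powr p)
          = 1 / s ^ DIM('a) * (((1 - s) powr (1 - p) * (1 - s) powr p) * (2 powr p * M powr p))"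
        by metis
      then show ?thesis
        using \<open>(2 * (1 - s)) powr p = _\<close> by (simp only: ac_simps) (simp add: ac_simps)
    qed
    moreover have "s powr (1 - p) * (1 / s ^ DIM('a)) = 1 / s ^ DIM('a) * s powr (1 - p)" by simp
    ultimately have eq: "1 / s ^ DIM('a) * (s powr (1 - p) + (1 - s) * (2 * M) powr p)
        = s powr (1 - p) * (1 / s ^ DIM('a)) + (1 - s) powr (1 - p) * M powr p * ((2 * (1 - s)) powr p / s ^ DIM('a))"
      by (simp only: distrib_left)
    have gen: "ennreal (a * b + c * d) = ennreal a * ennreal b + ennreal c * ennreal d"
      if "0 \<le> a" "0 \<le> b" "0 \<le> c" "0 \<le> d" for a b c d
      using that by (simp add: ennreal_mult)
    show ?thesis
      unfolding eq by (subst gen) (use s in \<open>simp_all only: distrib_right mult.assoc, auto\<close>)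
  qed
  finally show ?thesis .
qed

text \<open>The factor F s in \<open>dilation_interpolation\<close> tends to 1 as s increases to 1,
  because the cut-off \<theta> and its slope M do not depend on s. It suffices to take s with F s <
  1/g.\<close>

lemma capacity_ball_left_continuous:
  fixes p :: real
  assumes p: "1 \<le> p" and g: "0 < g" "g < 1"
  shows "\<exists>s. 0 < s \<and> s < 1 \<and>
    ennreal g * capacity p (cball (0::'a::euclidean_space) 1) (ball 0 2) \<le> capacity p (cball (0::'a) s) (ball 0 2)"
proof -
  obtain \<theta> :: "'a \<Rightarrow> real" where \<theta>: "\<theta> \<in> test_functions (ball 0 2)" "\<And>x. x \<in> cball 0 1 \<Longrightarrow> \<theta> x = 1"
      "\<And>x. 0 \<le> \<theta> x \<and> \<theta> x \<le> 1" "\<And>x y. norm x \<le> norm y \<Longrightarrow> \<theta> y \<le> \<theta> x"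
    using radial_cutoff_exists[of 1 2, where ?'a = 'a] by auto
  obtain M where M: "0 < M" "\<And>x. norm (gradient \<theta> x) \<le> M"
    by (rule gradient_bounded[OF \<theta>(1)]) (rule that)
  define F where "F s = 1 / s ^ DIM('a) * (s powr (1 - p) + (1 - s) * (2 * M) powr p)" for s :: real
  have "(F \<longlongrightarrow> 1 / 1 ^ DIM('a) * (1 powr (1 - p) + (1 - 1) * (2 * M) powr p)) (at_left 1)"
    unfolding F_def by (intro tendsto_intros) auto
  then have "(F \<longlongrightarrow> 1) (at_left 1)" by simp
  moreover have "1 < 1 / g" using g by simp
  ultimately have "\<forall>\<^sub>F s in at_left 1. F s < 1 / g" by (rule order_tendstoD(2))
  moreover have "\<forall>\<^sub>F s in at_left 1. s \<in> {0<..<1::real}" by (rule eventually_at_left_real) simp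
  ultimately have "\<forall>\<^sub>F s in at_left (1::real). F s < 1 / g \<and> s \<in> {0<..<1}" by (rule eventually_conj)
  then obtain s where s: "F s < 1 / g" "0 < s" "s < 1"
    using eventually_happens'[OF trivial_limit_at_left_real] by auto
  have "ennreal g * capacity p (cball (0::'a) 1) (ball 0 2) \<le> capacity p (cball (0::'a) s) (ball 0 2)"
  proof (rule capacity_greatest)
    fix f :: "'a \<Rightarrow> real"
    assume f: "f \<in> test_functions (ball 0 2)" "\<And>x. x \<in> cball 0 s \<Longrightarrow> 1 \<le> f x"
    have "capacity p (cball (0::'a) 1) (ball 0 2) \<le> ennreal (F s) * energy p f"
      unfolding F_def by (rule dilation_interpolation[OF p s(2,3) \<theta> M f])
    then have "ennreal g * capacity p (cball (0::'a) 1) (ball 0 2) \<le> ennreal g * (ennreal (F s) * energy p f)"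
      by (rule mult_left_mono) simp
    also have "\<dots> = ennreal (g * F s) * energy p f"
      using g by (simp add: ennreal_mult' mult.assoc)
    also have "\<dots> \<le> 1 * energy p f"
      using s g by (intro mult_right_mono) (auto simp: field_simps)
    finally show "ennreal g * capacity p (cball (0::'a) 1) (ball 0 2) \<le> energy p f" by simp
  qed
  with s show ?thesis by blast
qed

text \<open>\<open>t exp (- \<kappa> / t)\<close> is a smooth substitute for the positive part: it vanishes for \<open>t \<le> 0\<close>,
  lies above \<open>t - \<kappa>\<close>, and its slope stays in \<open>[0, 1]\<close> because \<open>1 + x \<le> exp x\<close>.\<close>

definition soft_pos :: "real \<Rightarrow> real \<Rightarrow> real" where
  "soft_pos \<kappa> t = t * flat 0 (t / \<kappa>)"

lemma smooth_soft_pos: "smooth (soft_pos \<kappa>)"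
proof -
  have "smooth (\<lambda>t. flat 0 (0 + (1 / \<kappa>) *\<^sub>R t))" by (rule smooth_affine[OF smooth_flat])
  from smooth_mult[OF smooth_ident this] show ?thesis
    unfolding soft_pos_def[abs_def] by simp
qed

text \<open>The left side of the second bound is the derivative of \<open>x * flat 0 x\<close>, so
  this bound limits the slope of the substitute positive part.\<close>

lemma exp_neg_inverse_bounds:
  assumes "0 < x"
  shows "1 - inverse x \<le> flat 0 x" "flat 0 x + x * flat 2 x \<le> 1" "flat 0 x \<le> 1"
proof -
  show "1 - inverse x \<le> flat 0 x"
    using assms exp_ge_add_one_self[of "- inverse x"] by (simp add: flat_def)
  have "flat 0 x + x * flat 2 x = exp (- inverse x) * (1 + inverse x)"
    using assms by (simp add: flat_def power2_eq_square field_simps)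
  also have "\<dots> \<le> exp (- inverse x) * exp (inverse x)"
    by (intro mult_left_mono exp_ge_add_one_self) simp
  finally show "flat 0 x + x * flat 2 x \<le> 1" by (simp add: exp_minus)
  show "flat 0 x \<le> 1" using assms by (simp add: flat_def)
qed

lemma soft_pos_eq_0: "0 < \<kappa> \<Longrightarrow> t \<le> 0 \<Longrightarrow> soft_pos \<kappa> t = 0"
  by (simp add: soft_pos_def flat_def zero_less_divide_iff)

lemma soft_pos_nonneg: "0 < \<kappa> \<Longrightarrow> 0 \<le> soft_pos \<kappa> t"
  by (cases "0 < t") (simp_all add: soft_pos_eq_0, simp add: soft_pos_def flat_0_nonneg)

lemma soft_pos_le: "0 < \<kappa> \<Longrightarrow> soft_pos \<kappa> t \<le> \<bar>t\<bar>"
  using exp_neg_inverse_bounds(3)[of "t / \<kappa>"]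
  by (cases "0 < t") (simp_all add: soft_pos_eq_0, simp add: soft_pos_def mult_left_le)

lemma soft_pos_ge:
  assumes "0 < \<kappa>" shows "t - \<kappa> \<le> soft_pos \<kappa> t"
proof (cases "0 < t")
  case True
  then have "t * (1 - inverse (t / \<kappa>)) \<le> t * flat 0 (t / \<kappa>)"
    using assms by (intro mult_left_mono exp_neg_inverse_bounds) auto
  then show ?thesis using True by (simp add: soft_pos_def right_diff_distrib)
next
  case False
  then show ?thesis using assms by (simp add: soft_pos_eq_0)
qed

definition soft_pos_slope :: "real \<Rightarrow> real \<Rightarrow> real" where
  "soft_pos_slope \<kappa> t = flat 0 (t / \<kappa>) + t / \<kappa> * flat 2 (t / \<kappa>)"

lemma soft_pos_has_derivative:
  "(soft_pos \<kappa> has_real_derivative soft_pos_slope \<kappa> t) (at t)"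
proof -
  have f: "(flat 0 has_real_derivative flat 2 x) (at x)" for x
    using flat_has_derivative[of 0 x] by (simp add: numeral_2_eq_2)
  have "((\<lambda>t. flat 0 (t / \<kappa>)) has_real_derivative flat 2 (t / \<kappa>) * (1 / \<kappa>)) (at t)"
    by (rule DERIV_chain2[OF f DERIV_cdivide[OF DERIV_ident]])
  from DERIV_mult[OF DERIV_ident this] show ?thesis
    unfolding soft_pos_def[abs_def] soft_pos_slope_def by (simp add: ac_simps)
qed

lemma soft_pos_slope_bounds:
  assumes "0 < \<kappa>" shows "0 \<le> soft_pos_slope \<kappa> t" "soft_pos_slope \<kappa> t \<le> 1"
proof -
  have "0 \<le> soft_pos_slope \<kappa> t \<and> soft_pos_slope \<kappa> t \<le> 1"
  proof (cases "0 < t")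
    case True
    then have pos: "0 < t / \<kappa>" using assms by simp
    then have "0 \<le> t / \<kappa> * flat 2 (t / \<kappa>)"
      by (intro mult_nonneg_nonneg) (simp_all add: flat_def)
    then show ?thesis
      using exp_neg_inverse_bounds(2)[OF pos] flat_0_nonneg[of "t / \<kappa>"] unfolding soft_pos_slope_def by simp
  next
    case False
    then have "\<not> 0 < t / \<kappa>" using assms by (simp add: zero_less_divide_iff)
    then show ?thesis by (simp add: soft_pos_slope_def flat_def)
  qed
  then show "0 \<le> soft_pos_slope \<kappa> t" "soft_pos_slope \<kappa> t \<le> 1" by auto
qed

text \<open>The first estimate forces \<phi> to have mass whenever the energy of \<psi> is too small
  to carry the capacity of the ball of radius s. The second is a crude upper bound on the energy of
  \<phi>. Together they bound its Rayleigh quotient.\<close>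

lemma truncated_capacitary_function:
  fixes \<psi> \<eta> :: "'a::euclidean_space \<Rightarrow> real"
  assumes p: "1 \<le> p" and \<psi>: "\<psi> \<in> test_functions (ball 0 2)"
    and \<eta>: "\<eta> \<in> test_functions (ball 0 1)" "\<And>x. x \<in> cball 0 s \<Longrightarrow> \<eta> x = 1"
      "\<And>x. 0 \<le> \<eta> x \<and> \<eta> x \<le> 1"
    and M: "0 < M" "\<And>x. norm (gradient \<eta> x) \<le> M"
    and t: "0 < t" "t < 1 / 2"
  shows "\<exists>\<phi>\<in>test_functions (ball 0 1 \<inter> {x. \<psi> x < 1}).
    ennreal ((1 - 2 * t) powr p) * capacity p (cball (0::'a) s) (ball 0 2)
      \<le> ennreal ((1 - t) powr (1 - p)) * energy p \<psi> + ennreal (t powr (1 - p) * (2 * M) powr p) * mass p \<phi> \<and>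
    energy p \<phi> \<le> ennreal (2 powr (p - 1)) * (ennreal (M powr p * 2 powr (p - 1)) *
      (ennreal (unit_ball_vol DIM('a)) + mass p \<psi>) + energy p \<psi>)"
proof -
  note s\<psi> = test_functions_smooth[OF \<psi>] and s\<eta> = test_functions_smooth[OF \<eta>(1)]
  \<comment> \<open>Shifting by t makes w vanish already where \<psi> is at least 1 - t. The support
    of \<phi> thus lies in a closed sublevel set inside the open set where \<psi> < 1, hence is
    compact.\<close>
  define w where "w x = soft_pos t ((1 - t) - \<psi> x)" for x
  define d where "d x = soft_pos_slope t ((1 - t) - \<psi> x)" for x
  have sw: "smooth w" unfolding w_def
    by (rule smooth_compose[OF smooth_diff[OF smooth_const s\<psi>] smooth_soft_pos])
  have gw: "gradient w x = - (d x *\<^sub>R gradient \<psi> x)" for x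
    unfolding w_def d_def
    using gradient_compose[OF smooth_diff[OF smooth_const s\<psi>] soft_pos_has_derivative, of t "1 - t" x]
    by (simp add: gradient_const_diff[OF s\<psi>])
  have d: "0 \<le> d x" "d x \<le> 1" for x
    unfolding d_def by (rule soft_pos_slope_bounds[OF t(1)])+
  have w0: "0 \<le> w x" and w1: "w x \<le> 1 + \<bar>\<psi> x\<bar>" and w2: "1 - 2 * t - \<psi> x \<le> w x" for x
    unfolding w_def using soft_pos_nonneg[OF t(1)] soft_pos_le[OF t(1), of "1 - t - \<psi> x"]
      soft_pos_ge[OF t(1), of "1 - t - \<psi> x"] t by auto
  define \<phi> where "\<phi> x = \<eta> x * w x" for x
  have s\<phi>: "smooth \<phi>" unfolding \<phi>_def by (rule smooth_mult[OF s\<eta> sw])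
  obtain L where L: "compact L" "L \<subseteq> ball 0 1" "\<And>x. x \<notin> L \<Longrightarrow> \<eta> x = 0"
    using test_functions_support[OF \<eta>(1)] by auto
  have \<phi>: "\<phi> \<in> test_functions (ball 0 1 \<inter> {x. \<psi> x < 1})"
  proof (rule test_functionsI[OF s\<phi>, of "L \<inter> {x. \<psi> x \<le> 1 - t}"])
    show "compact (L \<inter> {x. \<psi> x \<le> 1 - t})"
      by (intro compact_Int_closed L(1) closed_Collect_le smooth_continuous_on[OF s\<psi>] continuous_on_const)
    show "L \<inter> {x. \<psi> x \<le> 1 - t} \<subseteq> ball 0 1 \<inter> {x. \<psi> x < 1}" using L(2) t by auto
    show "\<phi> x = 0" if "x \<notin> L \<inter> {x. \<psi> x \<le> 1 - t}" for x
    proof (cases "x \<in> L")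
      case True
      then have "w x = 0" using that unfolding w_def by (intro soft_pos_eq_0[OF t(1)]) auto
      then show ?thesis by (simp add: \<phi>_def)
    next
      case False
      then show ?thesis by (simp add: \<phi>_def L(3))
    qed
  qed
  have g\<phi>: "gradient \<phi> x = \<eta> x *\<^sub>R gradient w x + w x *\<^sub>R gradient \<eta> x" for x
    unfolding \<phi>_def by (rule gradient_mult[OF s\<eta> sw])
  note [measurable] = measurable_norm_gradient[OF s\<psi>] measurable_smooth[OF s\<psi>] measurable_smooth[OF s\<phi>]
  define v where "v x = \<psi> x + \<phi> x * \<eta> x" for x
  have v: "v \<in> test_functions (ball 0 2)"
  proof -
    have "\<phi> \<in> test_functions (ball 0 2)" by (rule test_functions_mono[OF \<phi>]) auto
    then show ?thesis
      unfolding v_def by (intro test_functions_add[OF \<psi> test_functions_mult[OF _ s\<eta>]])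
  qed
  \<comment> \<open>Here w subtracts from the gradient of \<psi>, and the product rule for the
    square of \<eta> supplies the factor 2 \<phi>.\<close>
  have gv: "gradient v x = (1 - (\<eta> x)\<^sup>2 * d x) *\<^sub>R gradient \<psi> x + (2 * \<phi> x) *\<^sub>R gradient \<eta> x" for x
    unfolding v_def gradient_add[OF s\<psi> smooth_mult[OF s\<phi> s\<eta>]] gradient_mult[OF s\<phi> s\<eta>] g\<phi> gw
    by (simp add: \<phi>_def power2_eq_square algebra_simps) (simp add: scaleR_left_distrib[symmetric])
  have "ennreal ((1 - 2 * t) powr p) * capacity p (cball (0::'a) s) (ball 0 2) \<le> energy p v"
  proof -
    have c: "0 < 1 - 2 * t" using t by simp
    \<comment> \<open>On the ball of radius s, v is only at least 1 - 2t: one t is lost to the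
      shift, the other to the smooth positive part. Division restores admissibility.\<close>
    define z where "z x = (1 / (1 - 2 * t)) * v x" for x
    have z: "z \<in> test_functions (ball 0 2)"
      using test_functions_mult[OF v smooth_const[of "1 / (1 - 2 * t)"]] by (simp add: z_def[abs_def] mult.commute)
    have "1 \<le> z x" if "x \<in> cball 0 s" for x
      using \<eta>(2)[OF that] w2[of x] c by (simp add: z_def v_def \<phi>_def)
    then have "capacity p (cball (0::'a) s) (ball 0 2) \<le> energy p z"
      by (rule capacity_le_energy[OF z])
    then have "ennreal ((1 - 2 * t) powr p) * capacity p (cball (0::'a) s) (ball 0 2)
        \<le> ennreal (\<bar>1 - 2 * t\<bar> powr p) * energy p z"
      using c by (simp add: mult_left_mono)
    also have "\<dots> = energy p (\<lambda>x. (1 - 2 * t) * z x)"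
      by (rule energy_cmult[symmetric, OF test_functions_smooth[OF z]])
    also have "(\<lambda>x. (1 - 2 * t) * z x) = v" using c by (simp add: z_def fun_eq_iff)
    finally show ?thesis .
  qed
  also have "energy p v \<le> (\<integral>\<^sup>+x. ennreal ((1 - t) powr (1 - p)) * ennreal (norm (gradient \<psi> x) powr p)
      + ennreal (t powr (1 - p) * (2 * M) powr p) * ennreal (\<bar>\<phi> x\<bar> powr p) \<partial>lborel)"
    unfolding energy_def
  proof (rule nn_integral_mono)
    fix x
    have "0 \<le> (\<eta> x)\<^sup>2 * d x" "(\<eta> x)\<^sup>2 * d x \<le> 1"
      using d[of x] \<eta>(3)[of x] by (auto intro!: mult_le_one power_le_one)
    then have "\<bar>1 - (\<eta> x)\<^sup>2 * d x\<bar> * norm (gradient \<psi> x) \<le> 1 * norm (gradient \<psi> x)"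
      by (intro mult_right_mono) auto
    moreover have "\<bar>2 * \<phi> x\<bar> * norm (gradient \<eta> x) \<le> \<bar>2 * \<phi> x\<bar> * M"
      by (intro mult_left_mono M) simp
    moreover have "norm (gradient v x) \<le> \<bar>1 - (\<eta> x)\<^sup>2 * d x\<bar> * norm (gradient \<psi> x) + \<bar>2 * \<phi> x\<bar> * norm (gradient \<eta> x)"
      unfolding gv by (rule norm_triangle_le) simp
    ultimately have "norm (gradient v x) \<le> norm (gradient \<psi> x) + (2 * M) * \<bar>\<phi> x\<bar>"
      by (simp add: abs_mult mult.commute mult.left_commute)
    then have "norm (gradient v x) powr p \<le> (norm (gradient \<psi> x) + (2 * M) * \<bar>\<phi> x\<bar>) powr p"
      using p by (intro powr_mono2) auto
    \<comment> \<open>The same t serves as splitting weight, so a single parameter makes all the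
      losses small.\<close>
    also have "\<dots> \<le> (1 - t) powr (1 - p) * norm (gradient \<psi> x) powr p + t powr (1 - p) * ((2 * M) * \<bar>\<phi> x\<bar>) powr p"
      using M p t by (intro powr_add_le) auto
    also have "\<dots> = (1 - t) powr (1 - p) * norm (gradient \<psi> x) powr p + (t powr (1 - p) * (2 * M) powr p) * \<bar>\<phi> x\<bar> powr p"
      using M by (simp add: powr_mult mult.assoc)
    finally have "ennreal (norm (gradient v x) powr p)
        \<le> ennreal ((1 - t) powr (1 - p) * norm (gradient \<psi> x) powr p + (t powr (1 - p) * (2 * M) powr p) * \<bar>\<phi> x\<bar> powr p)"
      by (rule ennreal_leI)
    also have "\<dots> = ennreal ((1 - t) powr (1 - p)) * ennreal (norm (gradient \<psi> x) powr p)
      + ennreal (t powr (1 - p) * (2 * M) powr p) * ennreal (\<bar>\<phi> x\<bar> powr p)"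
      by (simp add: ennreal_plus[symmetric] ennreal_mult[symmetric] del: ennreal_plus)
    finally show "ennreal (norm (gradient v x) powr p) \<le> \<dots>" .
  qed
  also have "\<dots> = ennreal ((1 - t) powr (1 - p)) * energy p \<psi> + ennreal (t powr (1 - p) * (2 * M) powr p) * mass p \<phi>"
    unfolding energy_def mass_def by (subst nn_integral_add) (simp_all add: nn_integral_cmult)
  finally have 1: "ennreal ((1 - 2 * t) powr p) * capacity p (cball (0::'a) s) (ball 0 2)
      \<le> ennreal ((1 - t) powr (1 - p)) * energy p \<psi> + ennreal (t powr (1 - p) * (2 * M) powr p) * mass p \<phi>" .
  define B where "B = ball (0::'a) 1"
  have [measurable]: "B \<in> sets borel" by (simp add: B_def)
  have eB: "emeasure lborel B = ennreal (unit_ball_vol DIM('a))"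
    by (simp add: B_def emeasure_ball)
  have "energy p \<phi> \<le> (\<integral>\<^sup>+x. ennreal (2 powr (p - 1)) * (ennreal (M powr p * 2 powr (p - 1)) *
      (indicator B x + ennreal (\<bar>\<psi> x\<bar> powr p)) + ennreal (norm (gradient \<psi> x) powr p)) \<partial>lborel)"
    unfolding energy_def
  proof (rule nn_integral_mono)
    fix x
    \<comment> \<open>The bound 1 + |\<psi>| for w is not integrable over the whole space. The
      gradient of \<eta> vanishes off the unit ball, so the constant 1 contributes only the volume
      of that ball.\<close>
    define I :: real where "I = indicator B x"
    have I: "0 \<le> I" by (simp add: I_def)
    have "norm (gradient \<eta> x) \<le> M * I"
    proof (cases "x \<in> B")
      case False
      then have "gradient \<eta> x = 0" using test_functions_support[OF \<eta>(1)] by (auto simp: B_def)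
      then show ?thesis using M I by simp
    qed (use M in \<open>simp add: I_def\<close>)
    then have "w x * norm (gradient \<eta> x) \<le> w x * (M * I)"
      by (rule mult_left_mono[OF _ w0])
    also have "\<dots> \<le> (1 + \<bar>\<psi> x\<bar>) * (M * I)"
      using M I by (intro mult_right_mono w1) auto
    finally have "w x * norm (gradient \<eta> x) \<le> (1 + \<bar>\<psi> x\<bar>) * (M * I)" .
    moreover have "\<eta> x * d x * norm (gradient \<psi> x) \<le> 1 * norm (gradient \<psi> x)"
      using d[of x] \<eta>(3)[of x] by (intro mult_right_mono mult_le_one) auto
    moreover have "norm (gradient \<phi> x) \<le> \<eta> x * d x * norm (gradient \<psi> x) + w x * norm (gradient \<eta> x)"
      unfolding g\<phi> gw using d[of x] \<eta>(3)[of x] w0[of x] by (intro norm_triangle_le) simp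
    ultimately have "norm (gradient \<phi> x) \<le> (1 + \<bar>\<psi> x\<bar>) * (M * I) + norm (gradient \<psi> x)" by simp
    then have "norm (gradient \<phi> x) powr p \<le> ((1 + \<bar>\<psi> x\<bar>) * (M * I) + norm (gradient \<psi> x)) powr p"
      using p by (intro powr_mono2) auto
    also have "\<dots> \<le> 2 powr (p - 1) * (((1 + \<bar>\<psi> x\<bar>) * (M * I)) powr p + norm (gradient \<psi> x) powr p)"
      using M I p by (intro powr_add_le_2) auto
    also have "((1 + \<bar>\<psi> x\<bar>) * (M * I)) powr p = M powr p * I * (1 + \<bar>\<psi> x\<bar>) powr p"
    proof -
      have "I powr p = I" by (simp add: I_def indicator_def)
      then show ?thesis by (simp add: powr_mult)
    qed
    also have "M powr p * I * (1 + \<bar>\<psi> x\<bar>) powr p \<le> M powr p * I * (2 powr (p - 1) * (1 powr p + \<bar>\<psi> x\<bar> powr p))"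
      using I p by (intro mult_left_mono powr_add_le_2) auto
    also have "\<dots> = M powr p * 2 powr (p - 1) * (I + I * \<bar>\<psi> x\<bar> powr p)"
      by (simp add: algebra_simps)
    also have "\<dots> \<le> M powr p * 2 powr (p - 1) * (I + 1 * \<bar>\<psi> x\<bar> powr p)"
      by (intro mult_left_mono add_left_mono mult_right_mono) (auto simp: I_def indicator_def)
    finally have le: "norm (gradient \<phi> x) powr p
        \<le> 2 powr (p - 1) * (M powr p * 2 powr (p - 1) * (I + \<bar>\<psi> x\<bar> powr p) + norm (gradient \<psi> x) powr p)"
      by simp
    have iI: "indicator B x = ennreal I" by (simp add: I_def indicator_def)
    have "ennreal (norm (gradient \<phi> x) powr p)
        \<le> ennreal (2 powr (p - 1) * (M powr p * 2 powr (p - 1) * (I + \<bar>\<psi> x\<bar> powr p) + norm (gradient \<psi> x) powr p))"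
      by (rule ennreal_leI[OF le])
    also have "\<dots> = ennreal (2 powr (p - 1)) * (ennreal (M powr p * 2 powr (p - 1)) *
      (indicator B x + ennreal (\<bar>\<psi> x\<bar> powr p)) + ennreal (norm (gradient \<psi> x) powr p))"
      unfolding iI using I by (simp add: ennreal_plus[symmetric] ennreal_mult[symmetric] del: ennreal_plus)
    finally show "ennreal (norm (gradient \<phi> x) powr p) \<le> \<dots>" .
  qed
  also have "\<dots> = ennreal (2 powr (p - 1)) * (ennreal (M powr p * 2 powr (p - 1)) *
      (ennreal (unit_ball_vol DIM('a)) + mass p \<psi>) + energy p \<psi>)"
    unfolding energy_def mass_def eB[symmetric]
    by (simp add: nn_integral_add nn_integral_cmult)
  finally show ?thesis
    using \<phi> 1 by (intro bexI[of _ \<phi>]) auto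
qed

section \<open>The Rayleigh quotient on the unit ball\<close>

lemma capacity_ball_finite:
  assumes "1 \<le> p"
  shows "capacity p (cball (0::'a::euclidean_space) 1) (ball 0 2) < \<infinity>"
proof -
  obtain \<theta> :: "'a \<Rightarrow> real" where \<theta>: "\<theta> \<in> test_functions (ball 0 2)" "\<And>x. x \<in> cball 0 1 \<Longrightarrow> \<theta> x = 1"
    using radial_cutoff_exists[of 1 2, where ?'a = 'a] by auto
  have "capacity p (cball (0::'a) 1) (ball 0 2) \<le> energy p \<theta>"
    by (rule capacity_le_energy[OF \<theta>(1)]) (simp add: \<theta>(2))
  also have "\<dots> < \<infinity>" by (rule energy_finite[OF \<theta>(1) assms])
  finally show ?thesis .
qed

lemma capacity_ball_eq_ennreal:
  assumes "1 \<le> p"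
  shows "\<exists>k>0. capacity p (cball (0::'a::euclidean_space) 1) (ball 0 2) = ennreal k"
proof -
  obtain k where k: "0 \<le> k" "capacity p (cball (0::'a) 1) (ball 0 2) = ennreal k"
    using capacity_ball_finite[OF assms, where ?'a = 'a]
    by (cases "capacity p (cball (0::'a) 1) (ball 0 2)") auto
  have "0 < ennreal (unit_ball_vol DIM('a) * 1 ^ DIM('a) / (4 * 1) powr p)" by simp
  also have "\<dots> \<le> ennreal k"
    using capacity_ball_ge[OF assms zero_less_one, of "0::'a"] k(2) by simp
  finally show ?thesis using k by (intro exI[of _ k]) auto
qed

text \<open>At t = 0 the inequality reads \<gamma> < g, and both sides are continuous there.\<close>

lemma truncation_parameter_exists:
  fixes g \<gamma> p :: real
  assumes "\<gamma> < g"
  shows "\<exists>t. 0 < t \<and> t < 1 / 2 \<and> (1 - t) powr (1 - p) * \<gamma> < (1 - 2 * t) powr p * g"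
proof -
  let ?H = "\<lambda>t::real. (1 - 2 * t) powr p * g - (1 - t) powr (1 - p) * \<gamma>"
  have "(?H \<longlongrightarrow> (1 - 2 * 0) powr p * g - (1 - 0) powr (1 - p) * \<gamma>) (at_right 0)"
    by (intro tendsto_intros) auto
  then have "(?H \<longlongrightarrow> g - \<gamma>) (at_right 0)" by simp
  moreover have "0 < g - \<gamma>" using assms by simp
  ultimately have "\<forall>\<^sub>F t in at_right 0. 0 < ?H t" by (rule order_tendstoD(1))
  moreover have "\<forall>\<^sub>F t in at_right 0. t \<in> {0<..<1/2::real}" by (rule eventually_at_right_real) simp
  ultimately have "\<forall>\<^sub>F t in at_right 0. 0 < ?H t \<and> t \<in> {0<..<1/2}" by (rule eventually_conj)
  then show ?thesis
    using eventually_happens'[OF trivial_limit_at_right_real] by fastforce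
qed

lemma unit_ball_test_function:
  fixes p \<gamma> :: real
  assumes p: "1 \<le> p" and \<gamma>: "0 < \<gamma>" "\<gamma> < 1"
  shows "\<exists>c>0. \<forall>\<psi>\<in>test_functions (ball (0::'a::euclidean_space) 2).
    energy p \<psi> \<le> ennreal \<gamma> * capacity p (cball (0::'a) 1) (ball 0 2) \<longrightarrow>
    (\<exists>\<phi>\<in>test_functions (ball 0 1 \<inter> {x. \<psi> x < 1}). mass p \<phi> \<noteq> 0 \<and> energy p \<phi> \<le> ennreal c * mass p \<phi>)"
proof -
  obtain k where k: "0 < k" "capacity p (cball (0::'a) 1) (ball 0 2) = ennreal k"
    using capacity_ball_eq_ennreal[OF p, where ?'a = 'a] by auto
  \<comment> \<open>The margin up to 1 is split: the gap from g to 1 is spent on shrinking the ball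
    to radius s, the gap from \<gamma> to g on the truncation parameter t.\<close>
  define g where "g = (1 + \<gamma>) / 2"
  have g: "0 < g" "g < 1" "\<gamma> < g" using \<gamma> by (auto simp: g_def)
  obtain s where s: "0 < s" "s < 1"
      "ennreal g * ennreal k \<le> capacity p (cball (0::'a) s) (ball 0 2)"
    using capacity_ball_left_continuous[OF p g(1,2), where ?'a = 'a] k(2) by auto
  obtain \<eta> :: "'a \<Rightarrow> real" where \<eta>: "\<eta> \<in> test_functions (ball 0 1)" "\<And>x. x \<in> cball 0 s \<Longrightarrow> \<eta> x = 1"
      "\<And>x. 0 \<le> \<eta> x \<and> \<eta> x \<le> 1"
    using radial_cutoff_exists[OF s(1,2), where ?'a = 'a] by auto
  obtain M where M: "0 < M" "\<And>x. norm (gradient \<eta> x) \<le> M"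
    by (rule gradient_bounded[OF \<eta>(1)]) (rule that)
  obtain t where t: "0 < t" "t < 1 / 2" "(1 - t) powr (1 - p) * \<gamma> < (1 - 2 * t) powr p * g"
    using truncation_parameter_exists[OF g(3), of p] by auto
  define A where "A = t powr (1 - p) * (2 * M) powr p"
  have A: "0 < A" using t M by (simp add: A_def)
  \<comment> \<open>The lower bound for the mass m of \<phi>, obtained by solving \<open>(1 - 2 * t)
    powr p * g * k \<le> (1 - t) powr (1 - p) * \<gamma> * k + A * m\<close> for m.\<close>
  define \<delta> where "\<delta> = k * ((1 - 2 * t) powr p * g - (1 - t) powr (1 - p) * \<gamma>) / A"
  have \<delta>: "0 < \<delta>" using k A t by (simp add: \<delta>_def)
  define w where "w = unit_ball_vol DIM('a)"
  have w: "0 < w" by (simp add: w_def)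
  \<comment> \<open>The energy bound for \<phi> with the energy of \<psi> replaced by \<gamma> k and
    its mass by \<open>4 powr p\<close> times that, 4 being the diameter of the ball of radius 2.
    Neither C nor \<delta> depends on \<psi>.\<close>
  define C where "C = 2 powr (p - 1) * (M powr p * 2 powr (p - 1) * (w + 4 powr p * (\<gamma> * k)) + \<gamma> * k)"
  have C: "0 < C"
    unfolding C_def using M w \<gamma> k by (intro mult_pos_pos add_pos_pos) auto
  have "\<exists>\<phi>\<in>test_functions (ball 0 1 \<inter> {x. \<psi> x < 1}). mass p \<phi> \<noteq> 0 \<and> energy p \<phi> \<le> ennreal (C / \<delta>) * mass p \<phi>"
    if \<psi>: "\<psi> \<in> test_functions (ball 0 2)" and le: "energy p \<psi> \<le> ennreal \<gamma> * ennreal k" for \<psi> :: "'a \<Rightarrow> real"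
  proof -
    obtain e where e: "energy p \<psi> = ennreal e" "0 \<le> e"
      using energy_finite[OF \<psi> p] by (cases "energy p \<psi>") auto
    have ek: "e \<le> \<gamma> * k"
      using le \<gamma> k unfolding e(1) by (simp add: ennreal_mult[symmetric])
    obtain \<phi> where \<phi>: "\<phi> \<in> test_functions (ball 0 1 \<inter> {x. \<psi> x < 1})"
      and 1: "ennreal ((1 - 2 * t) powr p) * capacity p (cball (0::'a) s) (ball 0 2)
        \<le> ennreal ((1 - t) powr (1 - p)) * energy p \<psi> + ennreal (t powr (1 - p) * (2 * M) powr p) * mass p \<phi>"
      and 2: "energy p \<phi> \<le> ennreal (2 powr (p - 1)) * (ennreal (M powr p * 2 powr (p - 1)) *
        (ennreal (unit_ball_vol DIM('a)) + mass p \<psi>) + energy p \<psi>)"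
      using truncated_capacitary_function[OF p \<psi> \<eta> M t(1,2)] by blast
    obtain m where m: "mass p \<phi> = ennreal m" "0 \<le> m"
      using mass_finite[OF \<phi> p] by (cases "mass p \<phi>") auto
    have "ennreal ((1 - 2 * t) powr p * (g * k)) \<le> ennreal ((1 - 2 * t) powr p) * capacity p (cball (0::'a) s) (ball 0 2)"
      using s(3) g k by (simp add: ennreal_mult mult_left_mono)
    also have "\<dots> \<le> ennreal ((1 - t) powr (1 - p) * e + A * m)"
      using 1 e(2) m(2) A unfolding e(1) m(1) A_def[symmetric] by (simp add: ennreal_mult)
    finally have "(1 - 2 * t) powr p * (g * k) \<le> (1 - t) powr (1 - p) * e + A * m"
      by (subst (asm) ennreal_le_iff) (use e(2) m(2) A in auto)
    also have "\<dots> \<le> (1 - t) powr (1 - p) * (\<gamma> * k) + A * m"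
      using ek by (intro add_right_mono mult_left_mono) auto
    finally have "\<delta> \<le> m"
      using A unfolding \<delta>_def by (simp add: field_simps)
    have "mass p \<psi> \<le> ennreal ((2 * 2) powr p) * energy p \<psi>"
      by (rule mass_le_energy_ball[OF \<psi> p]) simp
    also have "\<dots> \<le> ennreal (4 powr p * (\<gamma> * k))"
      unfolding e(1) using ek e(2) by (simp add: ennreal_mult[symmetric] ennreal_leI)
    finally have m\<psi>: "mass p \<psi> \<le> ennreal (4 powr p * (\<gamma> * k))" .
    have "energy p \<phi> \<le> ennreal (2 powr (p - 1)) * (ennreal (M powr p * 2 powr (p - 1)) *
        (ennreal w + mass p \<psi>) + energy p \<psi>)"
      using 2 by (simp add: w_def)
    also have "\<dots> \<le> ennreal (2 powr (p - 1)) * (ennreal (M powr p * 2 powr (p - 1)) *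
        (ennreal w + ennreal (4 powr p * (\<gamma> * k))) + ennreal (\<gamma> * k))"
      unfolding e(1) by (intro mult_left_mono add_mono m\<psi> ennreal_leI ek) auto
    also have "\<dots> = ennreal C"
      unfolding C_def using w \<gamma> k
      by (simp add: ennreal_plus[symmetric] ennreal_mult[symmetric] del: ennreal_plus)
    also have "\<dots> \<le> ennreal (C / \<delta> * m)"
      using \<open>\<delta> \<le> m\<close> \<delta> C by (intro ennreal_leI) (simp add: field_simps)
    also have "\<dots> = ennreal (C / \<delta>) * mass p \<phi>"
      unfolding m(1) by (rule ennreal_mult) (use \<delta> C m in auto)
    finally show ?thesis
      using \<phi> \<open>\<delta> \<le> m\<close> \<delta> m by (intro bexI[of _ \<phi>]) auto
  qed
  moreover have "0 < C / \<delta>" using C \<delta> by simp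
  ultimately show ?thesis unfolding k(2) by blast
qed

section \<open>Passing from the unit ball to arbitrary balls\<close>

lemma energy_rescale:
  fixes f :: "'a::euclidean_space \<Rightarrow> real"
  assumes "smooth f" "0 < r"
  shows "ennreal (r powr p) * energy p (\<lambda>x. f (- (1 / r) *\<^sub>R x0 + (1 / r) *\<^sub>R x)) = ennreal (r ^ DIM('a)) * energy p f"
proof -
  let ?E = "energy p (\<lambda>x. f (- (1 / r) *\<^sub>R x0 + (1 / r) *\<^sub>R x))"
  have "ennreal (\<bar>1 / r\<bar> ^ DIM('a)) * ?E = ennreal (\<bar>1 / r\<bar> powr p) * energy p f"
    by (rule energy_affine[OF assms(1)]) (use assms in simp)
  then have "ennreal (r ^ DIM('a) * r powr p) * (ennreal ((1 / r) ^ DIM('a)) * ?E)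
      = ennreal (r ^ DIM('a) * r powr p) * (ennreal ((1 / r) powr p) * energy p f)"
    using assms(2) by simp
  moreover have "r ^ DIM('a) * r powr p * (1 / r) ^ DIM('a) = r powr p"
    "r ^ DIM('a) * r powr p * (1 / r) powr p = r ^ DIM('a)"
    using assms(2) by (simp_all add: powr_divide power_divide)
  ultimately show ?thesis
    using assms(2) by (simp only: mult.assoc[symmetric] ennreal_mult''[symmetric] zero_le_power
        zero_le_divide_1_iff less_imp_le powr_ge_zero)
qed

lemma mass_rescale:
  fixes f :: "'a::euclidean_space \<Rightarrow> real"
  assumes "smooth f" "0 < r"
  shows "mass p (\<lambda>x. f (- (1 / r) *\<^sub>R x0 + (1 / r) *\<^sub>R x)) = ennreal (r ^ DIM('a)) * mass p f"
proof -
  let ?E = "mass p (\<lambda>x. f (- (1 / r) *\<^sub>R x0 + (1 / r) *\<^sub>R x))"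
  have "ennreal (\<bar>1 / r\<bar> ^ DIM('a)) * ?E = mass p f"
    by (rule mass_affine[OF assms(1)]) (use assms in simp)
  then have "ennreal (r ^ DIM('a)) * mass p f = (ennreal (r ^ DIM('a)) * ennreal ((1 / r) ^ DIM('a))) * ?E"
    using assms(2) by (simp add: mult.assoc)
  also have "ennreal (r ^ DIM('a)) * ennreal ((1 / r) ^ DIM('a)) = 1"
    using assms(2) by (simp add: ennreal_mult[symmetric] power_divide)
  finally show ?thesis by simp
qed

lemma capacity_ball_rescale_le:
  fixes x0 :: "'a::euclidean_space"
  assumes p: "1 \<le> p" and r: "0 < r"
  shows "ennreal (r powr p) * capacity p (cball x0 r) (ball x0 (2 * r))
    \<le> ennreal (r ^ DIM('a)) * capacity p (cball (0::'a) 1) (ball 0 2)"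
proof -
  have "ennreal (r powr p / r ^ DIM('a)) * capacity p (cball x0 r) (ball x0 (2 * r))
      \<le> capacity p (cball (0::'a) 1) (ball 0 2)"
  proof (rule capacity_greatest)
    fix f :: "'a \<Rightarrow> real"
    assume f: "f \<in> test_functions (ball 0 2)" "\<And>x. x \<in> cball 0 1 \<Longrightarrow> 1 \<le> f x"
    let ?f = "\<lambda>x. f (- (1 / r) *\<^sub>R x0 + (1 / r) *\<^sub>R x)"
    have "?f \<in> test_functions (ball x0 (2 * r))"
    proof (rule test_functions_mono[OF test_functions_affine[OF f(1)]])
      show "{x. - (1 / r) *\<^sub>R x0 + (1 / r) *\<^sub>R x \<in> ball 0 2} \<subseteq> ball x0 (2 * r)"
        unfolding mem_ball_0 norm_rescale[OF r] using r by (auto simp: field_simps)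
    qed (use r in simp)
    moreover have "1 \<le> ?f x" if "x \<in> cball x0 r" for x
      by (rule f(2)) (use that r in \<open>simp add: norm_rescale del: scaleR_minus_left\<close>)
    ultimately have "capacity p (cball x0 r) (ball x0 (2 * r)) \<le> energy p ?f"
      by (rule capacity_le_energy)
    then have "ennreal (r powr p) * capacity p (cball x0 r) (ball x0 (2 * r)) \<le> ennreal (r ^ DIM('a)) * energy p f"
      unfolding energy_rescale[OF test_functions_smooth[OF f(1)] r, of p x0, symmetric]
      by (rule mult_left_mono) simp
    then have "ennreal (1 / r ^ DIM('a)) * (ennreal (r powr p) * capacity p (cball x0 r) (ball x0 (2 * r)))
        \<le> ennreal (1 / r ^ DIM('a)) * (ennreal (r ^ DIM('a)) * energy p f)"
      by (rule mult_left_mono) simp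
    then show "ennreal (r powr p / r ^ DIM('a)) * capacity p (cball x0 r) (ball x0 (2 * r)) \<le> energy p f"
      using r by (simp add: mult.assoc[symmetric] ennreal_mult[symmetric])
  qed
  then have "ennreal (r ^ DIM('a)) * (ennreal (r powr p / r ^ DIM('a)) * capacity p (cball x0 r) (ball x0 (2 * r)))
      \<le> ennreal (r ^ DIM('a)) * capacity p (cball (0::'a) 1) (ball 0 2)"
    by (rule mult_left_mono) simp
  then show ?thesis
    using r by (simp add: mult.assoc[symmetric] ennreal_mult[symmetric])
qed

lemma poincare_const_le:
  fixes p \<gamma> :: real
  assumes p: "1 \<le> p" and \<gamma>: "0 < \<gamma>" "\<gamma> < 1"
  shows "\<exists>c>0. \<forall>r x0. \<forall>\<Omega>::'a::euclidean_space set. 0 < r \<longrightarrow>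
    capacity_negligible p \<gamma> x0 r (cball x0 r - \<Omega>) \<longrightarrow> poincare_const p \<Omega> * ennreal (r powr p) \<le> ennreal c"
proof -
  let ?N = "DIM('a)"
  \<comment> \<open>The infimum in the capacity need not be attained; the room between \<gamma> and
    \<gamma>' admits a competitor.\<close>
  define \<gamma>' where "\<gamma>' = (1 + \<gamma>) / 2"
  have \<gamma>': "0 < \<gamma>'" "\<gamma>' < 1" "\<gamma> < \<gamma>'" using \<gamma> by (auto simp: \<gamma>'_def)
  obtain c where c: "0 < c" and main: "\<And>\<psi>. \<psi> \<in> test_functions (ball (0::'a) 2) \<Longrightarrow>
      energy p \<psi> \<le> ennreal \<gamma>' * capacity p (cball (0::'a) 1) (ball 0 2) \<Longrightarrow>
      \<exists>\<phi>\<in>test_functions (ball 0 1 \<inter> {x. \<psi> x < 1}). mass p \<phi> \<noteq> 0 \<and> energy p \<phi> \<le> ennreal c * mass p \<phi>"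
    using unit_ball_test_function[OF p \<gamma>'(1,2), where ?'a = 'a] by blast
  have "poincare_const p \<Omega> * ennreal (r powr p) \<le> ennreal c"
    if r: "0 < r" and neg: "capacity_negligible p \<gamma> x0 r (cball x0 r - \<Omega>)" for r x0 and \<Omega> :: "'a set"
  proof -
    let ?B = "capacity p (cball x0 r) (ball x0 (2 * r))"
    let ?K = "capacity p (cball (0::'a) 1) (ball 0 2)"
    have rN: "ennreal (r ^ ?N) \<noteq> 0" "ennreal (r powr p) \<noteq> 0" using r by auto
    \<comment> \<open>Passing from \<gamma> to \<gamma>' is a strict gain only if the capacity of
      the ball is neither 0 nor infinite.\<close>
    have "?B \<noteq> 0"
    proof -
      have "0 < ennreal (unit_ball_vol ?N * r ^ ?N / (4 * r) powr p)" using r by simp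
      also have "\<dots> \<le> ?B" by (rule capacity_ball_ge[OF p r])
      finally show ?thesis by simp
    qed
    moreover have "?B \<noteq> \<infinity>"
    proof
      assume "?B = \<infinity>"
      then have "ennreal (r ^ ?N) * ?K = \<infinity>"
        using capacity_ball_rescale_le[OF p r, of x0] rN by (simp add: ennreal_mult_top top_unique)
      then show False using capacity_ball_finite[OF p, where ?'a = 'a]
        by (simp add: ennreal_mult_eq_top_iff)
    qed
    ultimately have "ennreal \<gamma> * ?B < ennreal \<gamma>' * ?B"
      using \<gamma> \<gamma>' by (cases ?B) (auto simp: ennreal_mult[symmetric] ennreal_less_iff)
    moreover have "capacity p (cball x0 r - \<Omega>) (ball x0 (2 * r)) \<le> ennreal \<gamma> * ?B"
      using neg by (simp add: capacity_negligible_def)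
    ultimately have "capacity p (cball x0 r - \<Omega>) (ball x0 (2 * r)) < ennreal \<gamma>' * ?B"
      by simp
    then obtain \<psi> where \<psi>: "\<psi> \<in> test_functions (ball x0 (2 * r))" "\<And>x. x \<in> cball x0 r - \<Omega> \<Longrightarrow> 1 \<le> \<psi> x"
        "energy p \<psi> < ennreal \<gamma>' * ?B"
      by (rule capacity_lessE) (rule that)
    define \<psi>1 where "\<psi>1 z = \<psi> (x0 + r *\<^sub>R z)" for z
    have \<psi>1: "\<psi>1 \<in> test_functions (ball 0 2)"
      unfolding \<psi>1_def
    proof (rule test_functions_mono[OF test_functions_affine[OF \<psi>(1)]])
      show "{z. x0 + r *\<^sub>R z \<in> ball x0 (2 * r)} \<subseteq> ball 0 2"
        using r by (auto simp: dist_norm)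
    qed (use r in simp)
    have "ennreal (r ^ ?N) * energy p \<psi>1 = ennreal (r powr p) * energy p \<psi>"
      unfolding \<psi>1_def using energy_affine[OF test_functions_smooth[OF \<psi>(1)], of r p x0] r by simp
    also have "\<dots> \<le> ennreal (r powr p) * (ennreal \<gamma>' * ?B)"
      by (rule mult_left_mono[OF less_imp_le[OF \<psi>(3)]]) simp
    also have "\<dots> \<le> ennreal \<gamma>' * (ennreal (r ^ ?N) * ?K)"
      using mult_left_mono[OF capacity_ball_rescale_le[OF p r, of x0], of "ennreal \<gamma>'"]
      by (simp add: mult.left_commute)
    finally have "ennreal (r ^ ?N) * energy p \<psi>1 \<le> ennreal (r ^ ?N) * (ennreal \<gamma>' * ?K)"
      by (simp add: mult.left_commute)
    then have "energy p \<psi>1 \<le> ennreal \<gamma>' * ?K"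
      using rN by (subst (asm) ennreal_mult_le_mult_iff) auto
    from main[OF \<psi>1 this] obtain \<phi> where \<phi>: "\<phi> \<in> test_functions (ball 0 1 \<inter> {x. \<psi>1 x < 1})"
      "mass p \<phi> \<noteq> 0" "energy p \<phi> \<le> ennreal c * mass p \<phi>" by auto
    note s\<phi> = test_functions_smooth[OF \<phi>(1)]
    define \<phi>1 where "\<phi>1 x = \<phi> (- (1 / r) *\<^sub>R x0 + (1 / r) *\<^sub>R x)" for x
    have "\<phi>1 \<in> test_functions \<Omega>"
      unfolding \<phi>1_def
    proof (rule test_functions_mono[OF test_functions_affine[OF \<phi>(1)]])
      show "{x. - (1 / r) *\<^sub>R x0 + (1 / r) *\<^sub>R x \<in> ball 0 1 \<inter> {x. \<psi>1 x < 1}} \<subseteq> \<Omega>"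
      proof
        fix x assume x: "x \<in> {x. - (1 / r) *\<^sub>R x0 + (1 / r) *\<^sub>R x \<in> ball 0 1 \<inter> {x. \<psi>1 x < 1}}"
        then have "norm (- (1 / r) *\<^sub>R x0 + (1 / r) *\<^sub>R x) < 1" by (simp del: scaleR_minus_left)
        then have "x \<in> cball x0 r"
          unfolding norm_rescale[OF r] using r by (simp add: field_simps)
        moreover have "x0 + r *\<^sub>R (- (1 / r) *\<^sub>R x0 + (1 / r) *\<^sub>R x) = x"
          using r by (simp add: scaleR_add_right scaleR_diff_right)
        then have "\<psi> x < 1" using x unfolding \<psi>1_def by (simp del: scaleR_minus_left)
        \<comment> \<open>On the part of the closed ball outside \<Omega> the competitor is at least
          1, so a point of the ball with \<psi> < 1 belongs to \<Omega>.\<close>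
        ultimately show "x \<in> \<Omega>" using \<psi>(2)[of x] by force
      qed
    qed (use r in simp)
    then have "poincare_const p \<Omega> * mass p \<phi>1 \<le> energy p \<phi>1"
      by (rule poincare_const_mass_le[OF _ p])
    then have "ennreal (r powr p) * (poincare_const p \<Omega> * (ennreal (r ^ ?N) * mass p \<phi>))
        \<le> ennreal (r powr p) * energy p \<phi>1"
      unfolding \<phi>1_def mass_rescale[OF s\<phi> r] by (rule mult_left_mono) simp
    also have "\<dots> = ennreal (r ^ ?N) * energy p \<phi>"
      unfolding \<phi>1_def by (rule energy_rescale[OF s\<phi> r])
    also have "\<dots> \<le> ennreal (r ^ ?N) * (ennreal c * mass p \<phi>)"
      by (rule mult_left_mono[OF \<phi>(3)]) simp
    finally have "(ennreal (r ^ ?N) * mass p \<phi>) * (poincare_const p \<Omega> * ennreal (r powr p))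
        \<le> (ennreal (r ^ ?N) * mass p \<phi>) * ennreal c"
      by (simp add: ac_simps)
    moreover have "ennreal (r ^ ?N) * mass p \<phi> \<noteq> 0" "ennreal (r ^ ?N) * mass p \<phi> < \<infinity>"
      using rN \<phi>(2) mass_finite[OF \<phi>(1) p] by (auto simp: ennreal_mult_less_top)
    ultimately show ?thesis
      by (subst (asm) ennreal_mult_le_mult_iff) auto
  qed
  with c show ?thesis by blast
qed

section \<open>The two-sided estimate\<close>

lemma epowr_inverse_ennreal:
  assumes "0 < x" "1 \<le> p"
  shows "epowr (1 / ennreal x) p = ennreal (1 / x powr p)"
proof -
  have "1 / ennreal x = ennreal (1 / x)"
    using divide_ennreal[of 1 x] assms by simp
  then show ?thesis
    using assms by (simp add: epowr_def powr_divide)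
qed

lemma capacitary_inradius_ge:
  assumes "0 < r" "capacity_negligible p \<gamma> x0 r (cball x0 r - \<Omega>)"
  shows "ennreal r \<le> capacitary_inradius p \<gamma> \<Omega>"
  unfolding capacitary_inradius_def using assms by (intro Sup_upper) auto

text \<open>No radius above the capacitary inradius admits a negligible ball, so the hypothesis
  applies to each of them, and r decreases to R. An infinite inradius makes the left side 0.\<close>

lemma poincare_const_lower_bound:
  fixes \<Omega> :: "'a::euclidean_space set"
  assumes p: "1 \<le> p" and \<sigma>: "0 < \<sigma>"
    and ge: "\<And>r. 0 < r \<Longrightarrow> (\<And>x0. \<not> capacity_negligible p \<gamma> x0 r (cball x0 r - \<Omega>)) \<Longrightarrow>
      ennreal (\<sigma> / r powr p) \<le> poincare_const p \<Omega>"
  shows "ennreal \<sigma> * epowr (1 / capacitary_inradius p \<gamma> \<Omega>) p \<le> poincare_const p \<Omega>"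
proof -
  let ?R = "capacitary_inradius p \<gamma> \<Omega>"
  have above: "ennreal (\<sigma> / r powr p) \<le> poincare_const p \<Omega>" if "?R < ennreal r" "0 < r" for r
    using ge[OF that(2)] capacitary_inradius_ge[OF that(2)] that(1) by (meson not_le)
  show ?thesis
  proof (cases "poincare_const p \<Omega>")
    case (real l)
    show ?thesis
    proof (cases ?R)
      case (real R)
      have bd: "\<sigma> \<le> l * r powr p" if "R < r" for r
      proof -
        have "0 < r" using that real(1) by simp
        then have "\<sigma> / r powr p \<le> l"
          using above[of r] that real \<open>0 \<le> l\<close> \<open>poincare_const p \<Omega> = ennreal l\<close>
          by (simp add: ennreal_less_iff)
        then show ?thesis using \<open>0 < r\<close> by (simp add: field_simps)
      qed
      have "((\<lambda>r. l * r powr p) \<longlongrightarrow> l * R powr p) (at_right R)"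
      proof (rule tendsto_mult_left)
        \<comment> \<open>Continuity on the closed half-line is required because R = 0 is not yet
          excluded.\<close>
        have "continuous_on {0..} (\<lambda>r::real. r powr p)"
          by (rule continuous_on_powr') (use p in \<open>auto intro!: continuous_intros\<close>)
        then have "((\<lambda>r. r powr p) \<longlongrightarrow> R powr p) (at R within {0..})"
          using real(1) by (simp add: continuous_on_def)
        then show "((\<lambda>r. r powr p) \<longlongrightarrow> R powr p) (at_right R)"
          by (rule tendsto_within_subset) (use real(1) in auto)
      qed
      then have le: "\<sigma> \<le> l * R powr p"
        by (rule tendsto_lowerbound)
          (auto simp: eventually_at_right_field bd intro!: exI[of _ "R + 1"])
      \<comment> \<open>R = 0 would give \<sigma> \<le> 0. So a finite Poincare constant forces a
        positive inradius, in accordance with 1/0 being infinite.\<close>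
      then have "0 < R" using real(1) \<sigma> p by (cases "R = 0") auto
      then have "\<sigma> * (1 / R powr p) \<le> l" using le by (simp add: field_simps)
      then have "ennreal (\<sigma> * (1 / R powr p)) \<le> ennreal l" by (rule ennreal_leI)
      then show ?thesis
        using real \<open>poincare_const p \<Omega> = ennreal l\<close> \<open>0 < R\<close> p \<sigma>
        by (simp add: epowr_inverse_ennreal ennreal_mult'[symmetric])
    next
      case top
      then show ?thesis using p by (simp add: epowr_def)
    qed
  qed simp
qed

text \<open>For a positive Poincare constant l the hypothesis caps every admissible radius, and
  hence their supremum, at \<open>(c / l) powr (1 / p)\<close>. Solving for l gives the claim
  without a limiting sequence of radii. An infinite inradius can thus occur only when l = 0.\<close>

lemma poincare_const_upper_bound:
  fixes \<Omega> :: "'a::euclidean_space set"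
  assumes p: "1 \<le> p" and c: "0 < c"
    and le: "\<And>r x0. 0 < r \<Longrightarrow> capacity_negligible p \<gamma> x0 r (cball x0 r - \<Omega>) \<Longrightarrow>
      poincare_const p \<Omega> * ennreal (r powr p) \<le> ennreal c"
  shows "poincare_const p \<Omega> \<le> ennreal c * epowr (1 / capacitary_inradius p \<gamma> \<Omega>) p"
proof -
  let ?R = "capacitary_inradius p \<gamma> \<Omega>"
  show ?thesis
  proof (cases "?R = 0")
    case True
    then show ?thesis using c by (simp add: epowr_def ennreal_mult_top)
  next
    case False
    have "\<exists>r x0. 0 < r \<and> capacity_negligible p \<gamma> x0 r (cball x0 r - \<Omega>)"
    proof (rule ccontr)
      assume "\<nexists>r x0. 0 < r \<and> capacity_negligible p \<gamma> x0 r (cball x0 r - \<Omega>)"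
      then have eq: "{ennreal r | r. 0 < r \<and> (\<exists>x\<^sub>0. capacity_negligible p \<gamma> x\<^sub>0 r (cball x\<^sub>0 r - \<Omega>))} = {}"
        by auto
      show False
        using False by (simp only: capacitary_inradius_def eq Sup_empty bot_ennreal)
    qed
    then obtain r0 x0 where r0: "0 < r0" "capacity_negligible p \<gamma> x0 r0 (cball x0 r0 - \<Omega>)"
      by (elim exE conjE) (rule that)
    have "poincare_const p \<Omega> * ennreal (r0 powr p) < \<infinity>"
      using le_less_trans[OF le[OF r0] ennreal_less_top] by simp
    then obtain l where l: "poincare_const p \<Omega> = ennreal l" "0 \<le> l"
      using r0(1) by (cases "poincare_const p \<Omega>") (auto simp: ennreal_top_mult)
    show ?thesis
    proof (cases "l = 0")
      case True
      then show ?thesis using l by simp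
    next
      case False
      then have l0: "0 < l" using l by simp
      have "?R \<le> ennreal ((c / l) powr (1 / p))"
        unfolding capacitary_inradius_def
      proof (rule Sup_least)
        fix x assume "x \<in> {ennreal r | r. 0 < r \<and> (\<exists>x\<^sub>0. capacity_negligible p \<gamma> x\<^sub>0 r (cball x\<^sub>0 r - \<Omega>))}"
        then obtain r x0 where r: "x = ennreal r" "0 < r" "capacity_negligible p \<gamma> x0 r (cball x0 r - \<Omega>)"
          by auto
        have "l * r powr p \<le> c"
          using le[OF r(2,3)] l c by (simp add: ennreal_mult'[symmetric])
        then have "r powr p \<le> c / l" using l0 by (simp add: field_simps)
        then have "(r powr p) powr (1 / p) \<le> (c / l) powr (1 / p)"
          using p by (intro powr_mono2) auto
        then have "r \<le> (c / l) powr (1 / p)" using r(2) p by (simp add: powr_powr)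
        then show "x \<le> ennreal ((c / l) powr (1 / p))" unfolding r(1) by (rule ennreal_leI)
      qed
      then obtain R where R: "?R = ennreal R" "0 \<le> R" "R \<le> (c / l) powr (1 / p)"
        by (cases ?R) (auto simp: top_unique)
      have R0: "0 < R" using R \<open>?R \<noteq> 0\<close> by (cases "R = 0") auto
      have "R powr p \<le> ((c / l) powr (1 / p)) powr p"
        using R p by (intro powr_mono2) auto
      also have "\<dots> = c / l" using p c l0 by (simp add: powr_powr)
      finally have "l \<le> c * (1 / R powr p)" using l0 R0 by (simp add: field_simps)
      then have "ennreal l \<le> ennreal (c * (1 / R powr p))" by (rule ennreal_leI)
      then show ?thesis
        using c p by (simp add: l(1) R(1) epowr_inverse_ennreal[OF R0] ennreal_mult'[symmetric])
    qed
  qed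
qed

lemma epowr_inverse_eq_0_iff:
  assumes "1 \<le> p"
  shows "epowr (1 / x) p = 0 \<longleftrightarrow> x = \<infinity>"
proof (cases x)
  case (real r)
  show ?thesis
  proof (cases "r = 0")
    case True
    then show ?thesis using real by (simp add: epowr_def)
  next
    case False
    then show ?thesis using real assms by (simp add: epowr_inverse_ennreal)
  qed
qed (simp add: epowr_def)

lemma poincare_const_capacitary_inradius:
  fixes p :: real
  assumes p: "1 \<le> p"
  shows "\<exists>(\<sigma>::real) (C::real \<Rightarrow> real).
    0 < \<sigma> \<and> (\<forall>\<gamma>. 0 < \<gamma> \<and> \<gamma> < 1 \<longrightarrow> 0 < C \<gamma>) \<and> filterlim C at_top (at_left 1) \<and>
    (\<forall>\<gamma> (\<Omega>::'a::euclidean_space set). 0 < \<gamma> \<and> \<gamma> < 1 \<and> open \<Omega> \<longrightarrow>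
       ennreal (\<sigma> * \<gamma>) * epowr (1 / capacitary_inradius p \<gamma> \<Omega>) p \<le> poincare_const p \<Omega> \<and>
       poincare_const p \<Omega> \<le> ennreal (C \<gamma>) * epowr (1 / capacitary_inradius p \<gamma> \<Omega>) p)"
proof -
  obtain \<sigma> where \<sigma>: "0 < \<sigma>" and lower: "\<And>\<gamma> r (\<Omega>::'a set). 0 < \<gamma> \<Longrightarrow> 0 < r \<Longrightarrow> open \<Omega> \<Longrightarrow>
      (\<And>x0. \<not> capacity_negligible p \<gamma> x0 r (cball x0 r - \<Omega>)) \<Longrightarrow>
      ennreal (\<sigma> * \<gamma> / r powr p) \<le> poincare_const p \<Omega>"
    using poincare_const_ge[OF p, where ?'a = 'a] by blast
  have "\<forall>\<gamma>. \<exists>c. 0 < \<gamma> \<longrightarrow> \<gamma> < 1 \<longrightarrow> 0 < c \<and> (\<forall>r x0. \<forall>\<Omega>::'a set. 0 < r \<longrightarrow>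
    capacity_negligible p \<gamma> x0 r (cball x0 r - \<Omega>) \<longrightarrow> poincare_const p \<Omega> * ennreal (r powr p) \<le> ennreal c)"
    using poincare_const_le[OF p, where ?'a = 'a] by blast
  then obtain c where "\<forall>\<gamma>. 0 < \<gamma> \<longrightarrow> \<gamma> < 1 \<longrightarrow> 0 < c \<gamma> \<and> (\<forall>r x0. \<forall>\<Omega>::'a set. 0 < r \<longrightarrow>
    capacity_negligible p \<gamma> x0 r (cball x0 r - \<Omega>) \<longrightarrow> poincare_const p \<Omega> * ennreal (r powr p) \<le> ennreal (c \<gamma>))"
    by (rule choice[THEN exE])
  then have c: "0 < c \<gamma>" and upper: "\<And>r x0. \<And>\<Omega>::'a set. 0 < r \<Longrightarrow>
      capacity_negligible p \<gamma> x0 r (cball x0 r - \<Omega>) \<Longrightarrow> poincare_const p \<Omega> * ennreal (r powr p) \<le> ennreal (c \<gamma>)"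
    if "0 < \<gamma>" "\<gamma> < 1" for \<gamma>
    using that by blast+
  \<comment> \<open>enlarging the constant costs nothing and forces the blow-up as \<open>\<gamma>\<close> tends to 1\<close>
  define C where "C \<gamma> = \<bar>c \<gamma>\<bar> + 1 / (1 - \<gamma>)" for \<gamma>
  have C: "0 < C \<gamma>" "c \<gamma> \<le> C \<gamma>" if "0 < \<gamma>" "\<gamma> < 1" for \<gamma>
    using c[OF that] that by (auto simp: C_def add_pos_pos)
  have "filterlim C at_top (at_left 1)"
  proof (rule filterlim_at_top_mono)
    have "filterlim (\<lambda>\<gamma>. inverse (1 - \<gamma>)) at_top (at_left (1::real))"
    proof (rule filterlim_compose[OF filterlim_inverse_at_top_right])
      show "filterlim (\<lambda>\<gamma>. 1 - \<gamma>) (at_right 0) (at_left (1::real))"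
        unfolding filterlim_at
        by (auto intro!: tendsto_eq_intros simp: eventually_at_left_field intro: exI[of _ 0])
    qed
    then show "filterlim (\<lambda>\<gamma>. 1 / (1 - \<gamma>)) at_top (at_left (1::real))"
      by (simp add: inverse_eq_divide)
    show "\<forall>\<^sub>F \<gamma> in at_left 1. 1 / (1 - \<gamma>) \<le> C \<gamma>"
      by (simp add: C_def)
  qed
  moreover have "ennreal (\<sigma> * \<gamma>) * epowr (1 / capacitary_inradius p \<gamma> \<Omega>) p \<le> poincare_const p \<Omega> \<and>
       poincare_const p \<Omega> \<le> ennreal (C \<gamma>) * epowr (1 / capacitary_inradius p \<gamma> \<Omega>) p"
    if \<gamma>: "0 < \<gamma>" "\<gamma> < 1" and \<Omega>: "open \<Omega>" for \<gamma> and \<Omega> :: "'a set"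
  proof
    show "ennreal (\<sigma> * \<gamma>) * epowr (1 / capacitary_inradius p \<gamma> \<Omega>) p \<le> poincare_const p \<Omega>"
      using \<sigma> \<gamma> lower[OF \<gamma>(1) _ \<Omega>] by (intro poincare_const_lower_bound p) auto
    have "poincare_const p \<Omega> \<le> ennreal (c \<gamma>) * epowr (1 / capacitary_inradius p \<gamma> \<Omega>) p"
      by (rule poincare_const_upper_bound[OF p c[OF \<gamma>] upper[OF \<gamma>]])
    also have "\<dots> \<le> ennreal (C \<gamma>) * epowr (1 / capacitary_inradius p \<gamma> \<Omega>) p"
      by (intro mult_right_mono ennreal_leI C \<gamma>) simp
    finally show "poincare_const p \<Omega> \<le> ennreal (C \<gamma>) * epowr (1 / capacitary_inradius p \<gamma> \<Omega>) p" .
  qed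
  ultimately show ?thesis
    using \<sigma> C by (intro exI[of _ \<sigma>] exI[of _ C] conjI) auto
qed

lemma poincare_const_pos_iff:
  fixes \<Omega> :: "'a::euclidean_space set"
  assumes p: "1 \<le> p" and \<gamma>: "0 < \<gamma>" "\<gamma> < 1" and \<Omega>: "open \<Omega>"
  shows "0 < poincare_const p \<Omega> \<longleftrightarrow> capacitary_inradius p \<gamma> \<Omega> < \<infinity>"
proof -
  obtain \<sigma> C where \<sigma>: "0 < \<sigma>"
      and b: "ennreal (\<sigma> * \<gamma>) * epowr (1 / capacitary_inradius p \<gamma> \<Omega>) p \<le> poincare_const p \<Omega>"
        "poincare_const p \<Omega> \<le> ennreal (C \<gamma>) * epowr (1 / capacitary_inradius p \<gamma> \<Omega>) p"
    using poincare_const_capacitary_inradius[OF p, where ?'a = 'a] \<gamma> \<Omega> by blast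
  have "0 < \<sigma> * \<gamma>" using \<sigma> \<gamma> by simp
  then have "poincare_const p \<Omega> = 0 \<longleftrightarrow> epowr (1 / capacitary_inradius p \<gamma> \<Omega>) p = 0"
    using b by auto
  then show ?thesis
    unfolding epowr_inverse_eq_0_iff[OF p] by (auto simp: zero_less_iff_neq_zero less_top)
qed

theorem mainTheorem1:
  fixes p :: real
  assumes "2 \<le> CARD('n::finite)" and "1 \<le> p" and "p \<le> real CARD('n)"
  shows "(\<exists>(\<sigma>::real) (C::real \<Rightarrow> real).
            0 < \<sigma> \<and> (\<forall>\<gamma>. 0 < \<gamma> \<and> \<gamma> < 1 \<longrightarrow> 0 < C \<gamma>) \<and> filterlim C at_top (at_left 1) \<and>
            (\<forall>\<gamma> (\<Omega>::(real^'n) set). 0 < \<gamma> \<and> \<gamma> < 1 \<and> open \<Omega> \<longrightarrow>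
               ennreal (\<sigma> * \<gamma>) * epowr (1 / capacitary_inradius p \<gamma> \<Omega>) p \<le> poincare_const p \<Omega> \<and>
               poincare_const p \<Omega> \<le> ennreal (C \<gamma>) * epowr (1 / capacitary_inradius p \<gamma> \<Omega>) p)) \<and>
         (\<forall>\<gamma> (\<Omega>::(real^'n) set). 0 < \<gamma> \<and> \<gamma> < 1 \<and> open \<Omega> \<longrightarrow>
            (0 < poincare_const p \<Omega> \<longleftrightarrow> capacitary_inradius p \<gamma> \<Omega> < \<infinity>)) \<and>
         (\<forall>\<gamma> \<gamma>' (\<Omega>::(real^'n) set).
            0 < \<gamma> \<and> \<gamma> < 1 \<and> 0 < \<gamma>' \<and> \<gamma>' < 1 \<and> open \<Omega> \<longrightarrow>
            (capacitary_inradius p \<gamma> \<Omega> < \<infinity> \<longleftrightarrow> capacitary_inradius p \<gamma>' \<Omega> < \<infinity>))"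
proof (rule conjI[OF poincare_const_capacitary_inradius[OF assms(2)]], intro conjI allI impI; elim conjE)
  fix \<gamma> :: real and \<Omega> :: "(real^'n) set"
  assume "0 < \<gamma>" "\<gamma> < 1" "open \<Omega>"
  then show "0 < poincare_const p \<Omega> \<longleftrightarrow> capacitary_inradius p \<gamma> \<Omega> < \<infinity>"
    by (rule poincare_const_pos_iff[OF assms(2)])
next
  fix \<gamma> \<gamma>' :: real and \<Omega> :: "(real^'n) set"
  assume \<gamma>: "0 < \<gamma>" "\<gamma> < 1" and \<gamma>': "0 < \<gamma>'" "\<gamma>' < 1" and \<Omega>: "open \<Omega>"
  show "capacitary_inradius p \<gamma> \<Omega> < \<infinity> \<longleftrightarrow> capacitary_inradius p \<gamma>' \<Omega> < \<infinity>"
    \<comment> \<open>Positivity of the Poincare constant does not mention \<gamma>, so it links the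
      two conditions.\<close>
    using poincare_const_pos_iff[OF assms(2) \<gamma> \<Omega>] poincare_const_pos_iff[OF assms(2) \<gamma>' \<Omega>]
    by (rule trans[OF sym])
qed

end
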